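(* Let $M=\bigoplus_{\lambda\in L}M_\lambda$ be an $L$-weight $U_{v,1}$-module, with generators acting by $E_i^{(1)},F_i^{(1)}$, etc. On the same vector space with the same weight decomposition define, for $m_\lambda\in M_\lambda$, $$K_i^{(t)}m_\lambda=v^{i\cdot\lambda}t^{\langle\lambda,i\rangle-\langle i,\lambda\rangle}m_\lambda,\qquad (K_i')^{(t)}m_\lambda=v^{-i\cdot\lambda}t^{\langle\lambda,i\rangle-\langle i,\lambda\rangle}m_\lambda,$$ $$E_i^{(t)}m_\lambda=t^{\langle\lambda,i\rangle}E_i^{(1)}m_\lambda,\qquad F_i^{(t)}m_\lambda=t^{d_i-\langle i,\lambda\rangle}F_i^{(1)}m_\lambda .$$ These formulas define an $L$-weight $U_{v,t}$-module, denoted $\Phi_t(M)$. For a weight-preserving $U_{v,1}$-module homomorphism $h:M\to N$ put $\Phi_t(h)=h$ on underlying vector spaces. Then $\Phi_t$ is an equivalence between the category of $L$-weight $U_{v,1}$-modules and the category of $L$-weight $U_{v,t}$-modules (with weight-preserving module homomorphisms); its inverse is obtained by replacing every displayed power of $t$ by its reciprocal (i.e. by multiplying, on weight-$\lambda$ vectors of a $U_{v,t}$-module, the actions of $K_i$ and $K_i'$ by $t^{-\langle\lambda,i\rangle+\langle i,\lambda\rangle}$, the action of $E_i$ by $t^{-\langle\lambda,i\rangle}$, and the action of $F_i$ by $t^{-d_i+\langle i,\lambda\rangle}$). Finite dimensionality, integrability, simplicity, and the highest-weight property are preserved by this equivalence.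
   Context: **Cartan data.** $I$ is a nonempty finite set and $\Omega=(\Omega_{ij})_{i,j\in I}$ an integer matrix with $\Omega_{ii}>0$; for $i\neq j$, $\Omega_{ij}\le 0$ and $(\Omega_{ij}+\Omega_{ji})/\Omega_{ii}\in\mathbb Z_{\le 0}$; and $\gcd_{i}\Omega_{ii}=1$. $Q=\mathbb Z[I]$ is the root lattice (free abelian on $I$). Bilinear forms on $Q$: $\langle i,j\rangle=\Omega_{ij}$ and $i\cdot j=\Omega_{ij}+\Omega_{ji}$. Put $d_i=\Omega_{ii}=(i\cdot i)/2$, $a_{ij}=(i\cdot j)/d_i$. Finite type is assumed: $\cdot$ is positive definite on $Q\otimes_{\mathbb Z}\mathbb Q$. An admissible lattice is a free abelian group $L$ with $Q\subseteq L\subseteq Q\otimes_{\mathbb Z}\mathbb Q$, $[L:Q]<\infty$ (fixed throughout); both forms extend $\mathbb Q$-bilinearly. For $\lambda=\sum_i\lambda_ii\in L$, $\mathrm{ht}_d(\lambda)=\sum_id_i\lambda_i$. $D$ is a positive integer with $\lambda\cdot\mu,\langle\lambda,\mu\rangle,\mathrm{ht}_d(\lambda)\in D^{-1}\mathbb Z$ for all $\lambda,\mu\in L$; $v,t$ are algebraically independent variables and $\mathbb K_D=\mathbb Q(v^{1/D},t^{1/D})$. $v_i=v^{d_i}$, $t_i=t^{d_i}$. **The algebra.** $[p]_{v_i,t_i}=\frac{(v_it_i)^p-(v_it_i^{-1})^{-p}}{v_it_i-(v_it_i^{-1})^{-1}}$, $[p]_{v_i,t_i}!=\prod_{r=1}^p[r]_{v_i,t_i}$.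 $U_{v,t}$ is the $\mathbb K_D$-algebra generated by $E_i,F_i,K_i^{\pm1},(K_i')^{\pm1}$ ($i\in I$), all $K_i,K_i'$ commuting and invertible, with relations $K_iE_jK_i^{-1}=v^{i\cdot j}t^{\langle j,i\rangle-\langle i,j\rangle}E_j$, $K_i'E_jK_i'^{-1}=v^{-i\cdot j}t^{\langle j,i\rangle-\langle i,j\rangle}E_j$, $K_iF_jK_i^{-1}=v^{-i\cdot j}t^{\langle i,j\rangle-\langle j,i\rangle}F_j$, $K_i'F_jK_i'^{-1}=v^{i\cdot j}t^{\langle i,j\rangle-\langle j,i\rangle}F_j$, $E_iF_j-F_jE_i=\delta_{ij}\frac{K_i-K_i'}{v_i-v_i^{-1}}$, and for $i\ne j$, $N_{ij}=1-a_{ij}$, with $E_i^{(p)}=E_i^p/[p]_{v_i,t_i}!$, $F_i^{(p)}=F_i^p/[p]_{v_i,t_i}!$, $\kappa_{ij}(p,p')=(-1)^pt^{-d_ipp'+p\langle i,j\rangle-p\langle j,i\rangle}$: $\sum_{p+p'=N_{ij}}\kappa_{ij}(p,p')E_i^{(p)}E_jE_i^{(p')}=0$, $\sum_{p+p'=N_{ij}}\kappa_{ij}(p,p')F_i^{(p')}F_jF_i^{(p)}=0$ ($p,p'\ge0$). $U_{v,1}$ is obtained by evaluating all coefficients at $t=1$ and extending scalars from $\mathbb Q(v^{1/D})$ to $\mathbb K_D$. In the claim the superscripts $(1)$ and $(t)$ distinguish one- and two-parameter actions and are not divided powers. **Modules.** An $L$-weight $U_{v,t}$-module is a finite-dimensional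 module $M=\bigoplus_{\lambda\in L}M_\lambda$ with $E_iM_\lambda\subseteq M_{\lambda+i}$, $F_iM_\lambda\subseteq M_{\lambda-i}$, and $K_i=v^{i\cdot\lambda}t^{\langle\lambda,i\rangle-\langle i,\lambda\rangle}$, $K_i'=v^{-i\cdot\lambda}t^{\langle\lambda,i\rangle-\langle i,\lambda\rangle}$ on $M_\lambda$. For $U_{v,1}$ put $t=1$ in these formulas. Integrable: every $E_i,F_i$ acts locally nilpotently. Simple: no nonzero proper submodule. Highest-weight of highest weight $\Lambda$: generated by a nonzero $m_\Lambda\in M_\Lambda$ with $E_im_\Lambda=0$ for all $i$. *)

theory Defs
  imports
    "HOL-Analysis.Finite_Cartesian_Product"
    "HOL-Computational_Algebra.Polynomial"
    "HOL-Computational_Algebra.Fraction_Field"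
    "HOL-Library.Poly_Mapping"
    "HOL-Library.FuncSet"
    "HOL-Algebra.QuotRing"
    "HOL-Algebra.Module"
begin

section \<open>Cartan data, root lattice and admissible lattices\<close>

text \<open>The index set is a finite type (hence nonempty), and \<open>rat ^ 'i\<close> is the rational span of the
  root lattice, whose standard basis vector \<open>axis i 1\<close> is the element \<open>i\<close> of the root lattice.\<close>

definition simple_root :: "'i::finite \<Rightarrow> rat ^ 'i" where
  "simple_root i = axis i 1"

text \<open>\<open>eform\<close> is the non-symmetric form with matrix \<open>\<Omega>\<close>, \<open>sform\<close> its symmetrisation
  (written with a dot in the literature), both extended bilinearly to the rational span.\<close>

definition eform :: "('i::finite \<Rightarrow> 'i \<Rightarrow> int) \<Rightarrow> rat ^ 'i \<Rightarrow> rat ^ 'i \<Rightarrow> rat" where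
  "eform \<Omega> x y = (\<Sum>i\<in>UNIV. \<Sum>j\<in>UNIV. x $ i * y $ j * of_int (\<Omega> i j))"

definition sform :: "('i::finite \<Rightarrow> 'i \<Rightarrow> int) \<Rightarrow> rat ^ 'i \<Rightarrow> rat ^ 'i \<Rightarrow> rat" where
  "sform \<Omega> x y = (\<Sum>i\<in>UNIV. \<Sum>j\<in>UNIV. x $ i * y $ j * of_int (\<Omega> i j + \<Omega> j i))"

definition ht_d :: "('i::finite \<Rightarrow> 'i \<Rightarrow> int) \<Rightarrow> rat ^ 'i \<Rightarrow> rat" where
  "ht_d \<Omega> x = (\<Sum>i\<in>UNIV. of_int (\<Omega> i i) * x $ i)"

definition cartan_entry :: "('i \<Rightarrow> 'i \<Rightarrow> int) \<Rightarrow> 'i \<Rightarrow> 'i \<Rightarrow> int" where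
  "cartan_entry \<Omega> i j = (\<Omega> i j + \<Omega> j i) div \<Omega> i i"

locale finite_cartan_datum =
  fixes \<Omega> :: "'i::finite \<Rightarrow> 'i \<Rightarrow> int"
  assumes diag_pos: "\<Omega> i i > 0"
    and offdiag_nonpos: "i \<noteq> j \<Longrightarrow> \<Omega> i j \<le> 0"
    and cartan_integral: "i \<noteq> j \<Longrightarrow> \<exists>k\<le>0. \<Omega> i j + \<Omega> j i = k * \<Omega> i i"
    and gcd_diag: "Gcd (range (\<lambda>i. \<Omega> i i)) = 1"
    and finite_type: "x \<noteq> 0 \<Longrightarrow> sform \<Omega> x x > 0"

definition root_lattice :: "(rat ^ 'i::finite) set" where
  "root_lattice = {x. \<forall>i. x $ i \<in> \<int>}"

text \<open>Freeness of \<open>L\<close> is not listed: it follows from the finite index of the root lattice in \<open>L\<close>,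
  since \<open>L\<close> is then a finitely generated torsion-free abelian group.\<close>

locale admissible_lattice =
  fixes L :: "(rat ^ 'i::finite) set"
  assumes zero_mem: "0 \<in> L"
    and add_mem: "x \<in> L \<Longrightarrow> y \<in> L \<Longrightarrow> x + y \<in> L"
    and minus_mem: "x \<in> L \<Longrightarrow> - x \<in> L"
    and root_lattice_subset: "root_lattice \<subseteq> L"
    and finite_index: "finite ((\<lambda>x. (\<lambda>q. x + q) ` root_lattice) ` L)"

locale common_denominator =
  fixes \<Omega> :: "'i::finite \<Rightarrow> 'i \<Rightarrow> int" and L :: "(rat ^ 'i) set" and D :: nat
  assumes D_pos: "D > 0"
    and D_sform: "x \<in> L \<Longrightarrow> y \<in> L \<Longrightarrow> of_nat D * sform \<Omega> x y \<in> \<int>"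
    and D_eform: "x \<in> L \<Longrightarrow> y \<in> L \<Longrightarrow> of_nat D * eform \<Omega> x y \<in> \<int>"
    and D_ht: "x \<in> L \<Longrightarrow> of_nat D * ht_d \<Omega> x \<in> \<int>"


section \<open>The ground field\<close>

text \<open>The field of rational functions over the rationals in two variables, which stand for
  \<open>v\<^sup>1\<^sup>/\<^sup>D\<close> and \<open>t\<^sup>1\<^sup>/\<^sup>D\<close>. The field itself does not depend on \<open>D\<close>;
  the integer \<open>D\<close> enters when powers of \<open>v\<close> and \<open>t\<close> are formed with \<open>fpow\<close>.\<close>

type_synonym ratfun = "rat poly poly fract"

definition v_root :: ratfun where
  "v_root = Fract [:[:0, 1:]:] 1"

definition t_root :: ratfun where
  "t_root = Fract [:0, 1:] 1"

text \<open>If \<open>z\<close> is the chosen \<open>D\<close>-th root of \<open>w\<close>, then \<open>fpow D z q\<close> is \<open>w\<^sup>q\<close>, for exponents \<open>q\<close>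
  with \<open>D * q\<close> integral; the floor merely converts the integral rational \<open>D * q\<close> to an integer.\<close>

definition fpow :: "nat \<Rightarrow> ratfun \<Rightarrow> rat \<Rightarrow> ratfun" where
  "fpow D z q = z powi \<lfloor>of_nat D * q\<rfloor>"

definition ground_ring :: "ratfun ring" where
  "ground_ring = \<lparr>carrier = UNIV, monoid.mult = (*), one = 1, zero = 0, add = (+)\<rparr>"


section \<open>The two-parameter algebra\<close>

datatype 'i gen = GE 'i | GF 'i | GK 'i | GK_inv 'i | GK' 'i | GK'_inv 'i

datatype 'i word = Word (letters: "'i gen list")

text \<open>Words form a monoid under concatenation, written additively because \<open>poly_mapping\<close> multiplies
  monomials by adding indices. The noncommutative ring \<open>'i free_alg\<close> is therefore the free
  associative unital algebra on the generators.\<close>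

instantiation word :: (type) monoid_add
begin
definition zero_word :: "'a word" where "zero_word = Word []"
definition plus_word :: "'a word \<Rightarrow> 'a word \<Rightarrow> 'a word" where
  "plus_word a b = Word (letters a @ letters b)"
instance
  by standard (simp_all add: zero_word_def plus_word_def)
end

type_synonym 'i free_alg = "'i word \<Rightarrow>\<^sub>0 ratfun"

definition scal :: "ratfun \<Rightarrow> 'i free_alg" where
  "scal c = Poly_Mapping.single 0 c"

definition letter :: "'i gen \<Rightarrow> 'i free_alg" where
  "letter g = Poly_Mapping.single (Word [g]) 1"

definition free_ring :: "'i free_alg ring" where
  "free_ring = \<lparr>carrier = UNIV, monoid.mult = (*), one = 1, zero = 0, add = (+)\<rparr>"

definition qint :: "ratfun \<Rightarrow> ratfun \<Rightarrow> nat \<Rightarrow> ratfun" where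
  "qint v t p = ((v * t) ^ p - (v * inverse t) powi (- int p)) / (v * t - inverse (v * inverse t))"

definition qfact :: "ratfun \<Rightarrow> ratfun \<Rightarrow> nat \<Rightarrow> ratfun" where
  "qfact v t p = (\<Prod>r=1..p. qint v t r)"

text \<open>In what follows the argument \<open>y\<close> is the value given to \<open>t\<^sup>1\<^sup>/\<^sup>D\<close>: it is \<open>t_root\<close> for the
  two-parameter algebra and \<open>1\<close> for its specialisation at \<open>t = 1\<close>, which is taken over the same
  ground field.\<close>

definition v_pow :: "nat \<Rightarrow> rat \<Rightarrow> ratfun" where
  "v_pow D q = fpow D v_root q"

definition divpow ::
  "('i \<Rightarrow> 'i \<Rightarrow> int) \<Rightarrow> nat \<Rightarrow> ratfun \<Rightarrow> 'i \<Rightarrow> 'i free_alg \<Rightarrow> nat \<Rightarrow> 'i free_alg" where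
  "divpow \<Omega> D y i x p =
     scal (inverse (qfact (v_pow D (of_int (\<Omega> i i))) (fpow D y (of_int (\<Omega> i i))) p)) * x ^ p"

definition kappa ::
  "('i \<Rightarrow> 'i \<Rightarrow> int) \<Rightarrow> nat \<Rightarrow> ratfun \<Rightarrow> 'i \<Rightarrow> 'i \<Rightarrow> nat \<Rightarrow> nat \<Rightarrow> ratfun" where
  "kappa \<Omega> D y i j p p' = (- 1) ^ p *
     fpow D y (of_int (- (\<Omega> i i * int p * int p') + int p * \<Omega> i j - int p * \<Omega> j i))"

definition serre_E :: "('i \<Rightarrow> 'i \<Rightarrow> int) \<Rightarrow> nat \<Rightarrow> ratfun \<Rightarrow> 'i \<Rightarrow> 'i \<Rightarrow> 'i free_alg" where
  "serre_E \<Omega> D y i j = (let N = nat (1 - cartan_entry \<Omega> i j) in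
     \<Sum>p\<le>N. scal (kappa \<Omega> D y i j p (N - p)) *
       divpow \<Omega> D y i (letter (GE i)) p * letter (GE j) * divpow \<Omega> D y i (letter (GE i)) (N - p))"

definition serre_F :: "('i \<Rightarrow> 'i \<Rightarrow> int) \<Rightarrow> nat \<Rightarrow> ratfun \<Rightarrow> 'i \<Rightarrow> 'i \<Rightarrow> 'i free_alg" where
  "serre_F \<Omega> D y i j = (let N = nat (1 - cartan_entry \<Omega> i j) in
     \<Sum>p\<le>N. scal (kappa \<Omega> D y i j p (N - p)) *
       divpow \<Omega> D y i (letter (GF i)) (N - p) * letter (GF j) * divpow \<Omega> D y i (letter (GF i)) p)"

text \<open>The relators, i.e. left-hand side minus right-hand side of the defining relations.\<close>

definition relators :: "('i \<Rightarrow> 'i \<Rightarrow> int) \<Rightarrow> nat \<Rightarrow> ratfun \<Rightarrow> 'i free_alg set" where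
  "relators \<Omega> D y =
    (\<Union>i. {letter (GK i) * letter (GK_inv i) - 1, letter (GK_inv i) * letter (GK i) - 1,
           letter (GK' i) * letter (GK'_inv i) - 1, letter (GK'_inv i) * letter (GK' i) - 1}) \<union>
    (\<Union>i j. {letter (GK i) * letter (GK j) - letter (GK j) * letter (GK i),
             letter (GK i) * letter (GK' j) - letter (GK' j) * letter (GK i),
             letter (GK' i) * letter (GK' j) - letter (GK' j) * letter (GK' i)}) \<union>
    (\<Union>i j. {letter (GK i) * letter (GE j) * letter (GK_inv i)
               - scal (v_pow D (of_int (\<Omega> i j + \<Omega> j i)) * fpow D y (of_int (\<Omega> j i - \<Omega> i j)))
                 * letter (GE j),
             letter (GK' i) * letter (GE j) * letter (GK'_inv i)
               - scal (v_pow D (of_int (- (\<Omega> i j + \<Omega> j i))) * fpow D y (of_int (\<Omega> j i - \<Omega> i j)))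
                 * letter (GE j),
             letter (GK i) * letter (GF j) * letter (GK_inv i)
               - scal (v_pow D (of_int (- (\<Omega> i j + \<Omega> j i))) * fpow D y (of_int (\<Omega> i j - \<Omega> j i)))
                 * letter (GF j),
             letter (GK' i) * letter (GF j) * letter (GK'_inv i)
               - scal (v_pow D (of_int (\<Omega> i j + \<Omega> j i)) * fpow D y (of_int (\<Omega> i j - \<Omega> j i)))
                 * letter (GF j)}) \<union>
    (\<Union>i j. {letter (GE i) * letter (GF j) - letter (GF j) * letter (GE i)
               - (if i = j then
                    scal (inverse (v_pow D (of_int (\<Omega> i i)) - inverse (v_pow D (of_int (\<Omega> i i)))))
                      * (letter (GK i) - letter (GK' i))
                  else 0)}) \<union>
    (\<Union>i. \<Union>j\<in>- {i}. {serre_E \<Omega> D y i j, serre_F \<Omega> D y i j})"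

definition rel_ideal :: "('i \<Rightarrow> 'i \<Rightarrow> int) \<Rightarrow> nat \<Rightarrow> ratfun \<Rightarrow> 'i free_alg set" where
  "rel_ideal \<Omega> D y = genideal free_ring (relators \<Omega> D y)"

definition U_alg :: "('i \<Rightarrow> 'i \<Rightarrow> int) \<Rightarrow> nat \<Rightarrow> ratfun \<Rightarrow> 'i free_alg set ring" where
  "U_alg \<Omega> D y = free_ring Quot rel_ideal \<Omega> D y"

definition U_class ::
  "('i \<Rightarrow> 'i \<Rightarrow> int) \<Rightarrow> nat \<Rightarrow> ratfun \<Rightarrow> 'i free_alg \<Rightarrow> 'i free_alg set" where
  "U_class \<Omega> D y x = rel_ideal \<Omega> D y +>\<^bsub>free_ring\<^esub> x"

definition U_gen ::
  "('i \<Rightarrow> 'i \<Rightarrow> int) \<Rightarrow> nat \<Rightarrow> ratfun \<Rightarrow> 'i gen \<Rightarrow> 'i free_alg set" where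
  "U_gen \<Omega> D y g = U_class \<Omega> D y (letter g)"


section \<open>Weight modules\<close>

text \<open>A vector space (an HOL-Algebra module over \<open>ground_ring\<close>, with underlying set an arbitrary
  subset of \<open>'m\<close>) together with an action of the algebra and a family of weight spaces. The ring
  multiplication and unit that the HOL-Algebra record carries along play no role.\<close>

record ('i, 'm) wmod = "(ratfun, 'm) module" +
  act :: "'i free_alg set \<Rightarrow> 'm \<Rightarrow> 'm"
  wt :: "rat ^ 'i \<Rightarrow> 'm set"

text \<open>Left modules over the algebra. The action is extensional, i.e. it has the fixed value
  \<open>undefined\<close> outside the carriers, so that two actions that agree on the carriers are equal.\<close>

locale U_module =
  fixes \<Omega> :: "'i::finite \<Rightarrow> 'i \<Rightarrow> int" and D :: nat and y :: ratfun and M :: "('i, 'm) wmod"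
  assumes vector_space: "Module.module ground_ring M"
    and act_closed: "act M \<in> carrier (U_alg \<Omega> D y) \<rightarrow>\<^sub>E (carrier M \<rightarrow>\<^sub>E carrier M)"
    and act_add_right: "\<lbrakk>u \<in> carrier (U_alg \<Omega> D y); m \<in> carrier M; n \<in> carrier M\<rbrakk>
      \<Longrightarrow> act M u (m \<oplus>\<^bsub>M\<^esub> n) = act M u m \<oplus>\<^bsub>M\<^esub> act M u n"
    and act_add_left: "\<lbrakk>u \<in> carrier (U_alg \<Omega> D y); w \<in> carrier (U_alg \<Omega> D y); m \<in> carrier M\<rbrakk>
      \<Longrightarrow> act M (u \<oplus>\<^bsub>U_alg \<Omega> D y\<^esub> w) m = act M u m \<oplus>\<^bsub>M\<^esub> act M w m"
    and act_mult: "\<lbrakk>u \<in> carrier (U_alg \<Omega> D y); w \<in> carrier (U_alg \<Omega> D y); m \<in> carrier M\<rbrakk>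
      \<Longrightarrow> act M (u \<otimes>\<^bsub>U_alg \<Omega> D y\<^esub> w) m = act M u (act M w m)"
    and act_one: "m \<in> carrier M \<Longrightarrow> act M \<one>\<^bsub>U_alg \<Omega> D y\<^esub> m = m"
    and act_scal: "m \<in> carrier M \<Longrightarrow> act M (U_class \<Omega> D y (scal c)) m = c \<odot>\<^bsub>M\<^esub> m"

definition fin_dim :: "('i::finite, 'm) wmod \<Rightarrow> bool" where
  "fin_dim M \<longleftrightarrow> (\<exists>B. finite B \<and> B \<subseteq> carrier M \<and>
     (\<forall>m\<in>carrier M. \<exists>c. m = (\<Oplus>\<^bsub>M\<^esub>b\<in>B. c b \<odot>\<^bsub>M\<^esub> b)))"

text \<open>Internal direct sum: every vector is a unique finite sum of weight vectors.\<close>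

definition weight_decomposition :: "(rat ^ 'i::finite) set \<Rightarrow> ('i, 'm) wmod \<Rightarrow> bool" where
  "weight_decomposition L M \<longleftrightarrow>
     (\<forall>\<mu>\<in>L. submodule (wt M \<mu>) ground_ring M) \<and>
     (\<forall>m\<in>carrier M. \<exists>!f. (\<forall>\<mu>\<in>L. f \<mu> \<in> wt M \<mu>) \<and> (\<forall>\<mu>. \<mu> \<notin> L \<longrightarrow> f \<mu> = \<zero>\<^bsub>M\<^esub>) \<and>
        finite {\<mu>. f \<mu> \<noteq> \<zero>\<^bsub>M\<^esub>} \<and> m = (\<Oplus>\<^bsub>M\<^esub>\<mu>\<in>{\<mu>. f \<mu> \<noteq> \<zero>\<^bsub>M\<^esub>}. f \<mu>))"

locale weight_module = U_module \<Omega> D y M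
  for \<Omega> :: "'i::finite \<Rightarrow> 'i \<Rightarrow> int" and D :: nat and y :: ratfun and M :: "('i, 'm) wmod" +
  fixes L :: "(rat ^ 'i) set"
  assumes finite_dimensional: "fin_dim M"
    and decomposition: "weight_decomposition L M"
    and E_weight: "\<lbrakk>\<mu> \<in> L; m \<in> wt M \<mu>\<rbrakk>
      \<Longrightarrow> act M (U_gen \<Omega> D y (GE i)) m \<in> wt M (\<mu> + simple_root i)"
    and F_weight: "\<lbrakk>\<mu> \<in> L; m \<in> wt M \<mu>\<rbrakk>
      \<Longrightarrow> act M (U_gen \<Omega> D y (GF i)) m \<in> wt M (\<mu> - simple_root i)"
    and K_weight: "\<lbrakk>\<mu> \<in> L; m \<in> wt M \<mu>\<rbrakk> \<Longrightarrow> act M (U_gen \<Omega> D y (GK i)) m =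
        (v_pow D (sform \<Omega> (simple_root i) \<mu>)
          * fpow D y (eform \<Omega> \<mu> (simple_root i) - eform \<Omega> (simple_root i) \<mu>)) \<odot>\<^bsub>M\<^esub> m"
    and K'_weight: "\<lbrakk>\<mu> \<in> L; m \<in> wt M \<mu>\<rbrakk> \<Longrightarrow> act M (U_gen \<Omega> D y (GK' i)) m =
        (v_pow D (- sform \<Omega> (simple_root i) \<mu>)
          * fpow D y (eform \<Omega> \<mu> (simple_root i) - eform \<Omega> (simple_root i) \<mu>)) \<odot>\<^bsub>M\<^esub> m"

definition weight_hom ::
  "('i::finite \<Rightarrow> 'i \<Rightarrow> int) \<Rightarrow> nat \<Rightarrow> ratfun \<Rightarrow> (rat ^ 'i) set \<Rightarrow>
   ('i, 'm) wmod \<Rightarrow> ('i, 'm) wmod \<Rightarrow> ('m \<Rightarrow> 'm) set" where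
  "weight_hom \<Omega> D y L M N = {h \<in> carrier M \<rightarrow>\<^sub>E carrier N.
     (\<forall>m\<in>carrier M. \<forall>n\<in>carrier M. h (m \<oplus>\<^bsub>M\<^esub> n) = h m \<oplus>\<^bsub>N\<^esub> h n) \<and>
     (\<forall>c. \<forall>m\<in>carrier M. h (c \<odot>\<^bsub>M\<^esub> m) = c \<odot>\<^bsub>N\<^esub> h m) \<and>
     (\<forall>u\<in>carrier (U_alg \<Omega> D y). \<forall>m\<in>carrier M. h (act M u m) = act N u (h m)) \<and>
     (\<forall>\<mu>\<in>L. h ` wt M \<mu> \<subseteq> wt N \<mu>)}"

definition U_submodule ::
  "('i::finite \<Rightarrow> 'i \<Rightarrow> int) \<Rightarrow> nat \<Rightarrow> ratfun \<Rightarrow> ('i, 'm) wmod \<Rightarrow> 'm set \<Rightarrow> bool" where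
  "U_submodule \<Omega> D y M N \<longleftrightarrow> submodule N ground_ring M \<and>
     (\<forall>u\<in>carrier (U_alg \<Omega> D y). \<forall>m\<in>N. act M u m \<in> N)"

definition integrable_mod ::
  "('i::finite \<Rightarrow> 'i \<Rightarrow> int) \<Rightarrow> nat \<Rightarrow> ratfun \<Rightarrow> ('i, 'm) wmod \<Rightarrow> bool" where
  "integrable_mod \<Omega> D y M \<longleftrightarrow> (\<forall>i. \<forall>m\<in>carrier M.
     (\<exists>n. (act M (U_gen \<Omega> D y (GE i)) ^^ n) m = \<zero>\<^bsub>M\<^esub>) \<and>
     (\<exists>n. (act M (U_gen \<Omega> D y (GF i)) ^^ n) m = \<zero>\<^bsub>M\<^esub>))"

definition simple_mod ::
  "('i::finite \<Rightarrow> 'i \<Rightarrow> int) \<Rightarrow> nat \<Rightarrow> ratfun \<Rightarrow> ('i, 'm) wmod \<Rightarrow> bool" where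
  "simple_mod \<Omega> D y M \<longleftrightarrow>
     \<not> (\<exists>N. U_submodule \<Omega> D y M N \<and> N \<noteq> {\<zero>\<^bsub>M\<^esub>} \<and> N \<noteq> carrier M)"

definition highest_weight_mod ::
  "('i::finite \<Rightarrow> 'i \<Rightarrow> int) \<Rightarrow> nat \<Rightarrow> ratfun \<Rightarrow> rat ^ 'i \<Rightarrow> ('i, 'm) wmod \<Rightarrow> bool" where
  "highest_weight_mod \<Omega> D y \<Lambda> M \<longleftrightarrow> (\<exists>m\<in>wt M \<Lambda>. m \<noteq> \<zero>\<^bsub>M\<^esub> \<and>
     (\<forall>i. act M (U_gen \<Omega> D y (GE i)) m = \<zero>\<^bsub>M\<^esub>) \<and>
     (\<forall>N. U_submodule \<Omega> D y M N \<and> m \<in> N \<longrightarrow> N = carrier M))"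


section \<open>Categories and equivalences\<close>

text \<open>Hom-sets need not be disjoint, so composition is indexed by the three objects involved.\<close>

record ('o, 'a) cat =
  Ob :: "'o set"
  Hom :: "'o \<Rightarrow> 'o \<Rightarrow> 'a set"
  Ident :: "'o \<Rightarrow> 'a"
  Comp :: "'o \<Rightarrow> 'o \<Rightarrow> 'o \<Rightarrow> 'a \<Rightarrow> 'a \<Rightarrow> 'a"

locale is_category =
  fixes C :: "('o, 'a) cat"
  assumes Ident_Hom: "X \<in> Ob C \<Longrightarrow> Ident C X \<in> Hom C X X"
    and Comp_Hom: "\<lbrakk>X \<in> Ob C; Y \<in> Ob C; Z \<in> Ob C; f \<in> Hom C X Y; g \<in> Hom C Y Z\<rbrakk>
      \<Longrightarrow> Comp C X Y Z g f \<in> Hom C X Z"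
    and Ident_right: "\<lbrakk>X \<in> Ob C; Y \<in> Ob C; f \<in> Hom C X Y\<rbrakk> \<Longrightarrow> Comp C X X Y f (Ident C X) = f"
    and Ident_left: "\<lbrakk>X \<in> Ob C; Y \<in> Ob C; f \<in> Hom C X Y\<rbrakk> \<Longrightarrow> Comp C X Y Y (Ident C Y) f = f"
    and Comp_assoc: "\<lbrakk>W \<in> Ob C; X \<in> Ob C; Y \<in> Ob C; Z \<in> Ob C;
        f \<in> Hom C W X; g \<in> Hom C X Y; h \<in> Hom C Y Z\<rbrakk>
      \<Longrightarrow> Comp C W X Z (Comp C X Y Z h g) f = Comp C W Y Z h (Comp C W X Y g f)"

locale is_functor = C: is_category C + D: is_category D
  for C :: "('o, 'a) cat" and D :: "('p, 'b) cat" +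
  fixes Fo :: "'o \<Rightarrow> 'p" and Fa :: "'o \<Rightarrow> 'o \<Rightarrow> 'a \<Rightarrow> 'b"
  assumes F_Ob: "X \<in> Ob C \<Longrightarrow> Fo X \<in> Ob D"
    and F_Hom: "\<lbrakk>X \<in> Ob C; Y \<in> Ob C; f \<in> Hom C X Y\<rbrakk> \<Longrightarrow> Fa X Y f \<in> Hom D (Fo X) (Fo Y)"
    and F_Ident: "X \<in> Ob C \<Longrightarrow> Fa X X (Ident C X) = Ident D (Fo X)"
    and F_Comp: "\<lbrakk>X \<in> Ob C; Y \<in> Ob C; Z \<in> Ob C; f \<in> Hom C X Y; g \<in> Hom C Y Z\<rbrakk>
      \<Longrightarrow> Fa X Z (Comp C X Y Z g f) = Comp D (Fo X) (Fo Y) (Fo Z) (Fa Y Z g) (Fa X Y f)"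

definition isomorphism :: "('o, 'a) cat \<Rightarrow> 'o \<Rightarrow> 'o \<Rightarrow> 'a \<Rightarrow> bool" where
  "isomorphism C X Y f \<longleftrightarrow> f \<in> Hom C X Y \<and>
     (\<exists>g\<in>Hom C Y X. Comp C X Y X g f = Ident C X \<and> Comp C Y X Y f g = Ident C Y)"

definition natural_isomorphism ::
  "('o, 'a) cat \<Rightarrow> ('p, 'b) cat \<Rightarrow> ('o \<Rightarrow> 'p) \<Rightarrow> ('o \<Rightarrow> 'o \<Rightarrow> 'a \<Rightarrow> 'b) \<Rightarrow>
   ('o \<Rightarrow> 'p) \<Rightarrow> ('o \<Rightarrow> 'o \<Rightarrow> 'a \<Rightarrow> 'b) \<Rightarrow> ('o \<Rightarrow> 'b) \<Rightarrow> bool" where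
  "natural_isomorphism C D Fo Fa Go Ga \<eta> \<longleftrightarrow>
     (\<forall>X\<in>Ob C. isomorphism D (Fo X) (Go X) (\<eta> X)) \<and>
     (\<forall>X\<in>Ob C. \<forall>Y\<in>Ob C. \<forall>f\<in>Hom C X Y.
        Comp D (Fo X) (Fo Y) (Go Y) (\<eta> Y) (Fa X Y f) =
        Comp D (Fo X) (Go X) (Go Y) (Ga X Y f) (\<eta> X))"

definition equivalence_of_categories ::
  "('o, 'a) cat \<Rightarrow> ('p, 'b) cat \<Rightarrow> ('o \<Rightarrow> 'p) \<Rightarrow> ('o \<Rightarrow> 'o \<Rightarrow> 'a \<Rightarrow> 'b) \<Rightarrow>
   ('p \<Rightarrow> 'o) \<Rightarrow> ('p \<Rightarrow> 'p \<Rightarrow> 'b \<Rightarrow> 'a) \<Rightarrow> bool" where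
  "equivalence_of_categories C D Fo Fa Go Ga \<longleftrightarrow>
     is_functor C D Fo Fa \<and> is_functor D C Go Ga \<and>
     (\<exists>\<eta>. natural_isomorphism C C (\<lambda>X. X) (\<lambda>X Y f. f)
            (\<lambda>X. Go (Fo X)) (\<lambda>X Y f. Ga (Fo X) (Fo Y) (Fa X Y f)) \<eta>) \<and>
     (\<exists>\<epsilon>. natural_isomorphism D D (\<lambda>X. Fo (Go X)) (\<lambda>X Y f. Fa (Go X) (Go Y) (Ga X Y f))
            (\<lambda>X. X) (\<lambda>X Y f. f) \<epsilon>)"

definition weight_cat ::
  "('i::finite \<Rightarrow> 'i \<Rightarrow> int) \<Rightarrow> nat \<Rightarrow> ratfun \<Rightarrow> (rat ^ 'i) set \<Rightarrow>
   (('i, 'm) wmod, 'm \<Rightarrow> 'm) cat" where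
  "weight_cat \<Omega> D y L = \<lparr>Ob = {M. weight_module \<Omega> D y M L},
     Hom = weight_hom \<Omega> D y L,
     Ident = (\<lambda>M. \<lambda>m\<in>carrier M. m),
     Comp = (\<lambda>X Y Z g f. compose (carrier X) g f)\<rparr>"


section \<open>The twist functors\<close>

text \<open>\<open>twist_formulas \<Omega> D L M a\<close> says that the action \<open>a\<close> of the two-parameter algebra on the
  space of \<open>M\<close> is given on generators and weight vectors by the twisting formulas;
  \<open>untwist_formulas\<close> is the analogue for the reciprocal powers of \<open>t\<close>.\<close>

definition twist_formulas ::
  "('i::finite \<Rightarrow> 'i \<Rightarrow> int) \<Rightarrow> nat \<Rightarrow> (rat ^ 'i) set \<Rightarrow> ('i, 'm) wmod \<Rightarrow>
   ('i free_alg set \<Rightarrow> 'm \<Rightarrow> 'm) \<Rightarrow> bool" where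
  "twist_formulas \<Omega> D L M a \<longleftrightarrow> (\<forall>i. \<forall>\<mu>\<in>L. \<forall>m\<in>wt M \<mu>.
     a (U_gen \<Omega> D t_root (GK i)) m =
       (v_pow D (sform \<Omega> (simple_root i) \<mu>)
         * fpow D t_root (eform \<Omega> \<mu> (simple_root i) - eform \<Omega> (simple_root i) \<mu>)) \<odot>\<^bsub>M\<^esub> m \<and>
     a (U_gen \<Omega> D t_root (GK' i)) m =
       (v_pow D (- sform \<Omega> (simple_root i) \<mu>)
         * fpow D t_root (eform \<Omega> \<mu> (simple_root i) - eform \<Omega> (simple_root i) \<mu>)) \<odot>\<^bsub>M\<^esub> m \<and>
     a (U_gen \<Omega> D t_root (GE i)) m =
       fpow D t_root (eform \<Omega> \<mu> (simple_root i)) \<odot>\<^bsub>M\<^esub> act M (U_gen \<Omega> D 1 (GE i)) m \<and>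
     a (U_gen \<Omega> D t_root (GF i)) m =
       fpow D t_root (of_int (\<Omega> i i) - eform \<Omega> (simple_root i) \<mu>)
         \<odot>\<^bsub>M\<^esub> act M (U_gen \<Omega> D 1 (GF i)) m)"

definition untwist_formulas ::
  "('i::finite \<Rightarrow> 'i \<Rightarrow> int) \<Rightarrow> nat \<Rightarrow> (rat ^ 'i) set \<Rightarrow> ('i, 'm) wmod \<Rightarrow>
   ('i free_alg set \<Rightarrow> 'm \<Rightarrow> 'm) \<Rightarrow> bool" where
  "untwist_formulas \<Omega> D L N a \<longleftrightarrow> (\<forall>i. \<forall>\<mu>\<in>L. \<forall>m\<in>wt N \<mu>.
     a (U_gen \<Omega> D 1 (GK i)) m =
       fpow D t_root (- eform \<Omega> \<mu> (simple_root i) + eform \<Omega> (simple_root i) \<mu>)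
         \<odot>\<^bsub>N\<^esub> act N (U_gen \<Omega> D t_root (GK i)) m \<and>
     a (U_gen \<Omega> D 1 (GK' i)) m =
       fpow D t_root (- eform \<Omega> \<mu> (simple_root i) + eform \<Omega> (simple_root i) \<mu>)
         \<odot>\<^bsub>N\<^esub> act N (U_gen \<Omega> D t_root (GK' i)) m \<and>
     a (U_gen \<Omega> D 1 (GE i)) m =
       fpow D t_root (- eform \<Omega> \<mu> (simple_root i)) \<odot>\<^bsub>N\<^esub> act N (U_gen \<Omega> D t_root (GE i)) m \<and>
     a (U_gen \<Omega> D 1 (GF i)) m =
       fpow D t_root (- of_int (\<Omega> i i) + eform \<Omega> (simple_root i) \<mu>)
         \<odot>\<^bsub>N\<^esub> act N (U_gen \<Omega> D t_root (GF i)) m)"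

text \<open>The functors keep the vector space and the weight spaces and replace the action by the one
  that the formulas define. Existence and uniqueness of that action are not built into the
  definitions: they have to be proved.\<close>

definition Phi ::
  "('i::finite \<Rightarrow> 'i \<Rightarrow> int) \<Rightarrow> nat \<Rightarrow> (rat ^ 'i) set \<Rightarrow> ('i, 'm) wmod \<Rightarrow> ('i, 'm) wmod" where
  "Phi \<Omega> D L M = M\<lparr>act :=
     (THE a. weight_module \<Omega> D t_root (M\<lparr>act := a\<rparr>) L \<and> twist_formulas \<Omega> D L M a)\<rparr>"

definition Psi ::
  "('i::finite \<Rightarrow> 'i \<Rightarrow> int) \<Rightarrow> nat \<Rightarrow> (rat ^ 'i) set \<Rightarrow> ('i, 'm) wmod \<Rightarrow> ('i, 'm) wmod" where
  "Psi \<Omega> D L N = N\<lparr>act :=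
     (THE a. weight_module \<Omega> D 1 (N\<lparr>act := a\<rparr>) L \<and> untwist_formulas \<Omega> D L N a)\<rparr>"

end

theory Submission
  imports Defs
begin

text \<open>A generator acts on a weight vector in the twisted module by a power of \<open>t\<close> times its old action, and
  that power depends on the generator and the weight alone. A product of generators is therefore twisted
  by a scalar as well: the letters of a word act from right to left, each at the weight produced by the
  letters before it. Linear extension gives, for every weight \<open>\<mu>\<close>, an endomorphism of the vector space
  underlying the free algebra, \<open>twist_free\<close>, which multiplies each word by its scalar. The twisted action
  of \<open>x\<close> on the weight space of \<open>\<mu>\<close> has to be the old action of \<open>twist_free\<close> of \<open>x\<close>.

  Everything rests on the fact that this endomorphism sends each relator of the algebra with the new
  parameter to a scalar multiple of the same relator of the algebra with the old parameter
  (\<open>twist_free_relator\<close>): all monomials of a relator pick up the same scalar, once the powers of \<open>t\<close>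
  in its coefficients are taken into account. For the relations between Cartan generators and root
  vectors, and for the commutator of \<open>E\<^sub>i\<close> and \<open>F\<^sub>j\<close>, this is bilinearity of the form. For the Serre
  relations the monomial with exponents \<open>p\<close> and \<open>p'\<close> acquires, up to a factor common to all monomials,
  \<open>t\<close> to the power \<open>p' \<Omega>\<^sub>i\<^sub>j + p \<Omega>\<^sub>j\<^sub>i\<close>; the product of the two quantum factorials acquires a factor that
  is common to all monomials except for \<open>t\<close> to the power \<open>- d\<^sub>i p p'\<close>, and \<open>\<kappa>\<close> accounts exactly for both
  discrepancies. Since a weight module is the direct sum of its weight spaces, the actions on the weight
  spaces glue to a representation of the free algebra that kills the relators, hence to a module
  (\<open>twisted_action_exists\<close>). It is determined by the action of the generators on weight vectors
  (\<open>intertwines_rep\<close>), so it is unique, and homomorphisms are the same before and after twisting.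

  Twisting by \<open>t\<close> from parameter \<open>1\<close> and by the reciprocal of \<open>t\<close> from parameter \<open>t\<close> are instances of
  one construction, the twist by \<open>s\<close> from parameter \<open>y\<close> to \<open>y * s\<close>. The relation between a module and
  its twist is symmetric because the scalars are nonzero; with uniqueness this makes the two functors
  mutually inverse, not just quasi-inverse.

  For the invariants, a submodule is not assumed to be compatible with the weight decomposition.
  However, \<open>K\<^sub>i\<close> times the inverse of \<open>K'\<^sub>i\<close> acts on the weight space of \<open>\<mu>\<close> by \<open>v\<close> to the power twice the
  pairing of \<open>i\<close> and \<open>\<mu>\<close>, for every parameter. In finite type these eigenvalues separate the weights, so
  submodules are graded (\<open>submodule_component\<close>), and on weight vectors the two actions differ by
  scalars. Both modules hence have the same submodules.\<close>

section \<open>Powers of the ground variables\<close>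

text \<open>The exponents \<open>q\<close> for which \<open>fpow D z q\<close> is a genuine power of \<open>z\<close>, so that the laws of powers hold.\<close>

definition exponents :: "nat \<Rightarrow> rat set" where
  "exponents D = {q. of_nat D * q \<in> \<int>}"

lemma exponents_add [intro]: "p \<in> exponents D \<Longrightarrow> q \<in> exponents D \<Longrightarrow> p + q \<in> exponents D"
  by (simp add: exponents_def ring_distribs)

lemma exponents_uminus [intro]: "p \<in> exponents D \<Longrightarrow> - p \<in> exponents D"
  by (simp add: exponents_def)

lemma exponents_diff [intro]: "p \<in> exponents D \<Longrightarrow> q \<in> exponents D \<Longrightarrow> p - q \<in> exponents D"
  by (simp add: exponents_def ring_distribs)

lemma exponents_of_int [simp, intro]: "of_int k \<in> exponents D"
  by (simp add: exponents_def)

lemma fpow_nonzero [simp]: "z \<noteq> 0 \<Longrightarrow> fpow D z q \<noteq> 0"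
  by (simp add: fpow_def)

lemma fpow_0 [simp]: "fpow D z 0 = 1"
  by (simp add: fpow_def)

lemma fpow_base_1 [simp]: "fpow D 1 q = 1"
  by (simp add: fpow_def)

lemma fpow_base_mult: "fpow D (y * z) q = fpow D y q * fpow D z q"
  by (simp add: fpow_def power_int_mult_distrib)

lemma fpow_add:
  assumes "z \<noteq> 0" "p \<in> exponents D" "q \<in> exponents D"
  shows "fpow D z (p + q) = fpow D z p * fpow D z q"
proof -
  obtain k l where "of_nat D * p = of_int k" "of_nat D * q = of_int l"
    using assms(2,3) by (auto simp: exponents_def elim!: Ints_cases)
  then show ?thesis
    using assms(1) by (simp add: fpow_def ring_distribs power_int_add flip: of_int_add)
qed

lemma fpow_uminus:
  assumes "q \<in> exponents D"
  shows "fpow D z (- q) = inverse (fpow D z q)"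
proof -
  obtain k where "of_nat D * q = of_int k"
    using assms by (auto simp: exponents_def elim!: Ints_cases)
  then show ?thesis
    by (simp add: fpow_def power_int_minus flip: of_int_minus)
qed

lemma fpow_diff:
  assumes "z \<noteq> 0" "p \<in> exponents D" "q \<in> exponents D"
  shows "fpow D z (p - q) = fpow D z p * inverse (fpow D z q)"
  using fpow_add[of z p D "- q"] assms by (simp add: fpow_uminus exponents_uminus)

lemma fpow_base_inverse:
  assumes "q \<in> exponents D"
  shows "fpow D (inverse z) q = fpow D z (- q)"
  by (simp add: fpow_uminus[OF assms]) (simp add: fpow_def power_int_inverse)

lemma exponents_of_nat_mult [intro]: "q \<in> exponents D \<Longrightarrow> of_nat n * q \<in> exponents D"
  unfolding exponents_def by (metis (mono_tags, lifting) Ints_mult Ints_of_nat mem_Collect_eq mult.left_commute)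

lemma fpow_of_nat_mult:
  assumes "z \<noteq> 0" "q \<in> exponents D"
  shows "fpow D z (of_nat n * q) = fpow D z q ^ n"
proof (induction n)
  case (Suc n)
  have "fpow D z (of_nat (Suc n) * q) = fpow D z (q + of_nat n * q)"
    by (simp add: algebra_simps)
  also have "\<dots> = fpow D z q ^ Suc n"
    using assms Suc by (subst fpow_add) auto
  finally show ?case .
qed simp

lemma v_root_nonzero [simp]: "v_root \<noteq> 0"
  by (simp add: v_root_def Zero_fract_def eq_fract)

lemma t_root_nonzero [simp]: "t_root \<noteq> 0"
  by (simp add: t_root_def Zero_fract_def eq_fract)

lemma v_root_power: "v_root ^ n = Fract [:[:0, 1:] ^ n:] 1"
proof (induction n)
  case 0
  then show ?case by (simp add: One_fract_def one_pCons)
next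
  case (Suc n)
  then show ?case by (simp add: v_root_def)
qed

text \<open>As \<open>v\<close> is not a root of unity, its powers tell exponents apart, and Cartan eigenvalues can separate
  weights.\<close>

lemma v_root_power_neq_1:
  assumes "n > 0" shows "v_root ^ n \<noteq> 1"
proof
  assume "v_root ^ n = 1"
  then have "[:0, 1:] ^ n = (1 :: rat poly)"
    by (simp add: v_root_power One_fract_def eq_fract one_pCons)
  then have "degree ([:0, 1:] ^ n :: rat poly) = 0" by simp
  then show False using assms by (simp add: degree_power_eq)
qed

lemma v_root_powi_eq_iff: "v_root powi a = v_root powi b \<longleftrightarrow> a = b"
proof
  have aux: "b \<le> a" if "v_root powi a = v_root powi b" for a b
  proof (rule ccontr)
    assume "\<not> b \<le> a"
    have "v_root powi (b - a) = 1"
      using that by (simp add: power_int_diff)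
    then have "v_root ^ nat (b - a) = 1"
      using \<open>\<not> b \<le> a\<close> by (simp add: power_int_def)
    then show False using v_root_power_neq_1 \<open>\<not> b \<le> a\<close> by simp
  qed
  show "v_root powi a = v_root powi b \<Longrightarrow> a = b"
    using aux[of a b] aux[of b a] by simp
qed simp

lemma v_pow_eq_iff:
  assumes "D > 0" "p \<in> exponents D" "q \<in> exponents D"
  shows "v_pow D p = v_pow D q \<longleftrightarrow> p = q"
proof -
  obtain k l where kl: "of_nat D * p = of_int k" "of_nat D * q = of_int l"
    using assms(2,3) by (auto simp: exponents_def elim!: Ints_cases)
  have "v_pow D p = v_pow D q \<longleftrightarrow> k = l"
    using kl by (simp add: v_pow_def fpow_def v_root_powi_eq_iff)
  also have "\<dots> \<longleftrightarrow> of_nat D * p = of_nat D * q"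
    unfolding kl by simp
  finally show ?thesis using assms(1) by simp
qed

lemma v_pow_nonzero [simp]: "v_pow D q \<noteq> 0"
  by (simp add: v_pow_def)

text \<open>Replacing \<open>y\<close> by \<open>y * s\<close> multiplies \<open>v * y\<close> by \<open>s\<close> and divides \<open>v / y\<close> by \<open>s\<close>. As the latter occurs with
  negative exponents only, numerator and denominator are homogeneous in \<open>s\<close>, of degrees \<open>p\<close> and \<open>1\<close>.\<close>

lemma qint_rescale:
  assumes "s \<noteq> 0" "p > 0"
  shows "qint v (y * s) p = s ^ (p - 1) * qint v y p"
proof -
  have s: "s ^ p = s * s ^ (p - 1)"
    using assms(2) by (cases p) auto
  have "(v * (y * s)) ^ p - (v * inverse (y * s)) powi (- int p)
      = s ^ p * ((v * y) ^ p - (v * inverse y) powi (- int p))"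
    by (simp add: power_int_minus power_mult_distrib power_inverse field_simps)
  moreover have "v * (y * s) - inverse (v * inverse (y * s)) = s * (v * y - inverse (v * inverse y))"
    by (simp add: field_simps)
  ultimately show ?thesis
    using assms(1) by (simp add: qint_def s)
qed

lemma qfact_rescale:
  assumes "s \<noteq> 0"
  shows "qfact v (y * s) p = s ^ (p choose 2) * qfact v y p"
proof (induction p)
  case 0
  then show ?case by (simp add: qfact_def numeral_2_eq_2)
next
  case (Suc p)
  have "Suc p choose 2 = (p choose 2) + p"
    by (simp add: numeral_2_eq_2)
  then show ?case
    using Suc assms by (simp add: qfact_def qint_rescale power_add)
qed

lemma choose_two_add: "((m + n) choose 2) = (m choose 2) + (n choose 2) + m * n"
proof (induction m)
  case (Suc m)
  then show ?case by (simp add: numeral_2_eq_2)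
qed (simp add: numeral_2_eq_2)


section \<open>The free algebra and its quotients\<close>

lemma scal_0 [simp]: "scal 0 = 0"
  by (simp add: scal_def)

lemma scal_1 [simp]: "scal 1 = 1"
  by (simp add: scal_def)

lemma scal_mult: "scal (a * b) = scal a * scal b"
  by (simp add: scal_def mult_single)

lemma scal_uminus: "scal (- a) = - scal a"
  by (simp add: scal_def single_uminus)

lemma scal_mult_single: "scal c * Poly_Mapping.single w d = Poly_Mapping.single w (c * d)"
  by (simp add: scal_def mult_single)

lemma single_mult_scal: "Poly_Mapping.single w d * scal c = Poly_Mapping.single w (d * c)"
  by (simp add: scal_def mult_single)

lemma free_alg_additive_induct [case_names single add]:
  assumes "\<And>w c. P (Poly_Mapping.single w c)"
    and "\<And>x y. P x \<Longrightarrow> P y \<Longrightarrow> P (x + y)"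
  shows "P (x :: 'i free_alg)"
proof -
  have eq: "x = (\<Sum>w\<in>Poly_Mapping.keys x. Poly_Mapping.single w (Poly_Mapping.lookup x w))"
    by (rule poly_mapping_eqI)
      (auto simp: lookup_sum lookup_single when_def in_keys_iff sum.delta)
  have "P (\<Sum>w\<in>A. Poly_Mapping.single w (Poly_Mapping.lookup x w))" if "finite A" for A
    using that
  proof induction
    case empty
    show ?case using assms(1)[of 0 0] by simp
  qed (auto intro: assms)
  then show ?thesis by (subst eq) simp
qed

lemma single_Cons:
  "Poly_Mapping.single (Word (g # gs)) c = letter g * Poly_Mapping.single (Word gs) c"
  by (simp add: letter_def mult_single plus_word_def)

lemma single_Nil: "Poly_Mapping.single (Word []) c = scal c"
  by (simp add: scal_def zero_word_def)

lemma free_alg_induct [case_names scal letter add mult]: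
  assumes scal: "\<And>c. P (scal c)" and letter: "\<And>g. P (letter g)"
    and add: "\<And>x y. P x \<Longrightarrow> P y \<Longrightarrow> P (x + y)" and mult: "\<And>x y. P x \<Longrightarrow> P y \<Longrightarrow> P (x * y)"
  shows "P (x :: 'i free_alg)"
proof (induction x rule: free_alg_additive_induct)
  case (single w c)
  have "P (Poly_Mapping.single (Word gs) c)" for gs
  proof (induction gs)
    case Nil
    show ?case by (simp add: single_Nil scal)
  next
    case (Cons g gs)
    show ?case unfolding single_Cons by (rule mult[OF letter Cons])
  qed
  then show ?case by (cases w) simp
qed (rule add)

lemma scal_commute: "scal c * x = x * scal c"
  by (induction x rule: free_alg_additive_induct)
    (simp_all add: scal_mult_single single_mult_scal mult.commute ring_distribs)

lemma scal_left_commute: "x * (scal c * z) = scal c * (x * z)"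
  by (metis mult.assoc scal_commute)

lemma scal_scal_mult: "scal a * (scal b * x) = scal (a * b) * x"
  by (simp add: scal_mult mult.assoc)

lemma scal_collect:
  "scal k * (scal a * x) * y * (scal b * z) = scal (k * a * b) * (x * y * (z :: 'i free_alg))"
  by (simp only: mult.assoc scal_left_commute[of y] scal_left_commute[of x] scal_scal_mult)

lemma free_ring_simps [simp]:
  "carrier free_ring = UNIV" "mult free_ring = (*)" "one free_ring = 1"
  "zero free_ring = 0" "add free_ring = (+)"
  by (simp_all add: free_ring_def)

lemma ground_ring_simps [simp]:
  "carrier ground_ring = UNIV" "mult ground_ring = (*)" "one ground_ring = 1"
  "zero ground_ring = 0" "add ground_ring = (+)"
  by (simp_all add: ground_ring_def)

lemma ring_free_ring: "ring (free_ring :: 'i free_alg ring)"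
proof (rule ringI)
  show "abelian_group (free_ring :: 'i free_alg ring)"
  proof (rule abelian_groupI)
    show "\<exists>y\<in>carrier free_ring. y \<oplus>\<^bsub>free_ring\<^esub> x = \<zero>\<^bsub>free_ring\<^esub>" for x :: "'i free_alg"
      by (rule bexI[of _ "- x"]) simp_all
  qed (simp_all add: ac_simps)
  show "Group.monoid (free_ring :: 'i free_alg ring)"
    by (rule monoidI) (simp_all add: mult.assoc)
qed (simp_all add: ring_distribs)

interpretation free_ring: ring "free_ring :: 'i free_alg ring"
  by (rule ring_free_ring)

lemma ideal_rel_ideal: "ideal (rel_ideal \<Omega> D y) free_ring"
  unfolding rel_ideal_def by (rule free_ring.genideal_ideal) simp

lemma relators_subset_rel_ideal: "relators \<Omega> D y \<subseteq> rel_ideal \<Omega> D y"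
  unfolding rel_ideal_def by (rule free_ring.genideal_self) simp

lemma a_minus_free_ring [simp]: "x \<ominus>\<^bsub>free_ring\<^esub> y = x - (y :: 'i free_alg)"
proof -
  have "\<ominus>\<^bsub>free_ring\<^esub> y = - y"
    by (rule free_ring.minus_equality) simp_all
  then show ?thesis by (simp add: a_minus_def)
qed

lemma U_class_ring_hom: "U_class \<Omega> D y \<in> ring_hom free_ring (U_alg \<Omega> D y)"
proof -
  have "U_class \<Omega> D y = (+>\<^bsub>free_ring\<^esub>) (rel_ideal \<Omega> D y)"
    by (simp add: U_class_def fun_eq_iff)
  then show ?thesis
    unfolding U_alg_def using ideal.rcos_ring_hom[OF ideal_rel_ideal] by simp
qed

lemma U_class_add: "U_class \<Omega> D y (a + b) = U_class \<Omega> D y a \<oplus>\<^bsub>U_alg \<Omega> D y\<^esub> U_class \<Omega> D y b"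
  using ring_hom_add[OF U_class_ring_hom[of \<Omega> D y], of a b] by simp

lemma U_class_mult: "U_class \<Omega> D y (a * b) = U_class \<Omega> D y a \<otimes>\<^bsub>U_alg \<Omega> D y\<^esub> U_class \<Omega> D y b"
  using ring_hom_mult[OF U_class_ring_hom[of \<Omega> D y], of a b] by simp

lemma U_class_one: "U_class \<Omega> D y 1 = \<one>\<^bsub>U_alg \<Omega> D y\<^esub>"
  using ring_hom_one[OF U_class_ring_hom[of \<Omega> D y]] by simp

lemma carrier_U_alg: "carrier (U_alg \<Omega> D y) = range (U_class \<Omega> D y)"
  by (auto simp: U_alg_def FactRing_def A_RCOSETS_def RCOSETS_def U_class_def a_r_coset_def)

lemma U_class_closed [simp, intro]: "U_class \<Omega> D y x \<in> carrier (U_alg \<Omega> D y)"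
  by (simp add: carrier_U_alg)

lemma U_class_eq_iff: "U_class \<Omega> D y a = U_class \<Omega> D y b \<longleftrightarrow> a - b \<in> rel_ideal \<Omega> D y"
  using free_ring.quotient_eq_iff_same_a_r_cos[OF ideal_rel_ideal[of \<Omega> D y], of a b]
  by (simp add: U_class_def)

text \<open>The relators one by one, so that each of them can be cited without unfolding the whole set.\<close>

lemma relators_inverse:
  shows "letter (GK i) * letter (GK_inv i) - 1 \<in> relators \<Omega> D y"
    and "letter (GK_inv i) * letter (GK i) - 1 \<in> relators \<Omega> D y"
    and "letter (GK' i) * letter (GK'_inv i) - 1 \<in> relators \<Omega> D y"
    and "letter (GK'_inv i) * letter (GK' i) - 1 \<in> relators \<Omega> D y"
  unfolding relators_def
  by (rule UnI1, rule UnI1, rule UnI1, rule UnI1, rule UN_I[where a = i, OF UNIV_I],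
      (rule insertI1 | rule insertI2)+)+

lemma relators_commute:
  shows "letter (GK i) * letter (GK j) - letter (GK j) * letter (GK i) \<in> relators \<Omega> D y"
    and "letter (GK i) * letter (GK' j) - letter (GK' j) * letter (GK i) \<in> relators \<Omega> D y"
    and "letter (GK' i) * letter (GK' j) - letter (GK' j) * letter (GK' i) \<in> relators \<Omega> D y"
  unfolding relators_def
  by (rule UnI1, rule UnI1, rule UnI1, rule UnI2, rule UN_I[where a = i, OF UNIV_I], rule UN_I[where a = j, OF UNIV_I],
      (rule insertI1 | rule insertI2)+)+

lemma relators_conjugation:
  shows "letter (GK i) * letter (GE j) * letter (GK_inv i)
      - scal (v_pow D (of_int (\<Omega> i j + \<Omega> j i)) * fpow D y (of_int (\<Omega> j i - \<Omega> i j))) * letter (GE j) \<in> relators \<Omega> D y"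
    and "letter (GK' i) * letter (GE j) * letter (GK'_inv i)
      - scal (v_pow D (of_int (- (\<Omega> i j + \<Omega> j i))) * fpow D y (of_int (\<Omega> j i - \<Omega> i j))) * letter (GE j) \<in> relators \<Omega> D y"
    and "letter (GK i) * letter (GF j) * letter (GK_inv i)
      - scal (v_pow D (of_int (- (\<Omega> i j + \<Omega> j i))) * fpow D y (of_int (\<Omega> i j - \<Omega> j i))) * letter (GF j) \<in> relators \<Omega> D y"
    and "letter (GK' i) * letter (GF j) * letter (GK'_inv i)
      - scal (v_pow D (of_int (\<Omega> i j + \<Omega> j i)) * fpow D y (of_int (\<Omega> i j - \<Omega> j i))) * letter (GF j) \<in> relators \<Omega> D y"
  unfolding relators_def
  by (rule UnI1, rule UnI1, rule UnI2, rule UN_I[where a = i, OF UNIV_I], rule UN_I[where a = j, OF UNIV_I],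
      (rule insertI1 | rule insertI2)+)+

lemma relators_cross:
  shows "letter (GE i) * letter (GF j) - letter (GF j) * letter (GE i)
      - (if i = j then scal (inverse (v_pow D (of_int (\<Omega> i i)) - inverse (v_pow D (of_int (\<Omega> i i)))))
           * (letter (GK i) - letter (GK' i)) else 0) \<in> relators \<Omega> D y"
  unfolding relators_def
  by (rule UnI1, rule UnI2, rule UN_I[where a = i, OF UNIV_I], rule UN_I[where a = j, OF UNIV_I],
      (rule insertI1 | rule insertI2)+)+

lemma relators_serre:
  assumes "j \<in> - {i}"
  shows "serre_E \<Omega> D y i j \<in> relators \<Omega> D y"
    and "serre_F \<Omega> D y i j \<in> relators \<Omega> D y"
  unfolding relators_def
  by (rule UnI2, rule UN_I[where a = i, OF UNIV_I], rule UN_I[where a = j, OF assms],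
      (rule insertI1 | rule insertI2)+)+

lemma U_class_relator: "r \<in> relators \<Omega> D y \<Longrightarrow> U_class \<Omega> D y r = U_class \<Omega> D y 0"
  using relators_subset_rel_ideal by (auto simp: U_class_eq_iff)


section \<open>Weights and the scalars of the twist\<close>

lemma eform_add_left: "eform \<Omega> (a + b) c = eform \<Omega> a c + eform \<Omega> b c"
  by (simp add: eform_def ring_distribs sum.distrib)

lemma eform_add_right: "eform \<Omega> a (b + c) = eform \<Omega> a b + eform \<Omega> a c"
  by (simp add: eform_def ring_distribs sum.distrib)

lemma eform_uminus_left: "eform \<Omega> (- a) c = - eform \<Omega> a c"
  by (simp add: eform_def sum_negf)

lemma eform_uminus_right: "eform \<Omega> a (- c) = - eform \<Omega> a c"
  by (simp add: eform_def sum_negf)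

lemma eform_simple_root: "eform \<Omega> (simple_root i) (simple_root j) = of_int (\<Omega> i j)"
  by (simp add: eform_def simple_root_def axis_def if_distrib[of "\<lambda>x. x * _"] if_distrib[of "\<lambda>x. _ * x"]
      cong: if_cong)

fun gen_wt :: "'i::finite gen \<Rightarrow> rat ^ 'i" where
  "gen_wt (GE i) = simple_root i"
| "gen_wt (GF i) = - simple_root i"
| "gen_wt _ = 0"

definition cartan_exponent :: "('i::finite \<Rightarrow> 'i \<Rightarrow> int) \<Rightarrow> rat ^ 'i \<Rightarrow> 'i \<Rightarrow> rat" where
  "cartan_exponent \<Omega> \<mu> i = eform \<Omega> \<mu> (simple_root i) - eform \<Omega> (simple_root i) \<mu>"

text \<open>The exponents of the twisting formulas. The inverses of the Cartan generators do not occur in the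
  formulas; their exponents are forced, since they act by the inverse scalars.\<close>

fun gen_exponent :: "('i::finite \<Rightarrow> 'i \<Rightarrow> int) \<Rightarrow> rat ^ 'i \<Rightarrow> 'i gen \<Rightarrow> rat" where
  "gen_exponent \<Omega> \<mu> (GE i) = eform \<Omega> \<mu> (simple_root i)"
| "gen_exponent \<Omega> \<mu> (GF i) = of_int (\<Omega> i i) - eform \<Omega> (simple_root i) \<mu>"
| "gen_exponent \<Omega> \<mu> (GK i) = cartan_exponent \<Omega> \<mu> i"
| "gen_exponent \<Omega> \<mu> (GK' i) = cartan_exponent \<Omega> \<mu> i"
| "gen_exponent \<Omega> \<mu> (GK_inv i) = - cartan_exponent \<Omega> \<mu> i"
| "gen_exponent \<Omega> \<mu> (GK'_inv i) = - cartan_exponent \<Omega> \<mu> i"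

definition gen_scalar ::
  "('i::finite \<Rightarrow> 'i \<Rightarrow> int) \<Rightarrow> nat \<Rightarrow> ratfun \<Rightarrow> rat ^ 'i \<Rightarrow> 'i gen \<Rightarrow> ratfun" where
  "gen_scalar \<Omega> D s \<mu> g = fpow D s (gen_exponent \<Omega> \<mu> g)"

definition word_wt :: "'i::finite gen list \<Rightarrow> rat ^ 'i" where
  "word_wt gs = sum_list (map gen_wt gs)"

text \<open>The last letter of a word is applied first, so a letter sees the weight reached by the letters to
  its right.\<close>

fun word_scalar ::
  "('i::finite \<Rightarrow> 'i \<Rightarrow> int) \<Rightarrow> nat \<Rightarrow> ratfun \<Rightarrow> rat ^ 'i \<Rightarrow> 'i gen list \<Rightarrow> ratfun" where
  "word_scalar \<Omega> D s \<mu> [] = 1"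
| "word_scalar \<Omega> D s \<mu> (g # gs) = gen_scalar \<Omega> D s (\<mu> + word_wt gs) g * word_scalar \<Omega> D s \<mu> gs"

lemma word_wt_append: "word_wt (a @ b) = word_wt a + word_wt b"
  by (simp add: word_wt_def)

lemma word_scalar_append:
  "word_scalar \<Omega> D s \<mu> (a @ b) = word_scalar \<Omega> D s (\<mu> + word_wt b) a * word_scalar \<Omega> D s \<mu> b"
  by (induction a) (simp_all add: word_wt_append add_ac mult_ac)

lemma gen_scalar_nonzero [simp]: "s \<noteq> 0 \<Longrightarrow> gen_scalar \<Omega> D s \<mu> g \<noteq> 0"
  by (simp add: gen_scalar_def)

text \<open>The effect of the twist on weight vectors of weight \<open>\<mu>\<close>, read off in the free algebra. It is linear but
  not multiplicative: twisting a product shifts the weight at which the left factor is twisted.\<close>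

definition twist_free ::
  "('i::finite \<Rightarrow> 'i \<Rightarrow> int) \<Rightarrow> nat \<Rightarrow> ratfun \<Rightarrow> rat ^ 'i \<Rightarrow> 'i free_alg \<Rightarrow> 'i free_alg" where
  "twist_free \<Omega> D s \<mu> x = Poly_Mapping.mapp (\<lambda>w c. word_scalar \<Omega> D s \<mu> (letters w) * c) x"

lemma lookup_twist_free:
  "Poly_Mapping.lookup (twist_free \<Omega> D s \<mu> x) w = word_scalar \<Omega> D s \<mu> (letters w) * Poly_Mapping.lookup x w"
  by (auto simp: twist_free_def lookup_mapp when_def in_keys_iff)

lemma twist_free_add: "twist_free \<Omega> D s \<mu> (a + b) = twist_free \<Omega> D s \<mu> a + twist_free \<Omega> D s \<mu> b"
  by (rule poly_mapping_eqI) (simp add: lookup_twist_free lookup_add ring_distribs)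

lemma twist_free_diff: "twist_free \<Omega> D s \<mu> (a - b) = twist_free \<Omega> D s \<mu> a - twist_free \<Omega> D s \<mu> b"
  by (rule poly_mapping_eqI) (simp add: lookup_twist_free lookup_minus ring_distribs)

lemma twist_free_sum: "twist_free \<Omega> D s \<mu> (sum f A) = (\<Sum>a\<in>A. twist_free \<Omega> D s \<mu> (f a))"
  by (rule poly_mapping_eqI) (simp add: lookup_twist_free lookup_sum sum_distrib_left)

lemma twist_free_single:
  "twist_free \<Omega> D s \<mu> (Poly_Mapping.single w c) = Poly_Mapping.single w (word_scalar \<Omega> D s \<mu> (letters w) * c)"
  by (rule poly_mapping_eqI) (simp add: lookup_twist_free lookup_single when_def)

lemma twist_free_scal_mult: "twist_free \<Omega> D s \<mu> (scal c * x) = scal c * twist_free \<Omega> D s \<mu> x"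
  by (induction x rule: free_alg_additive_induct)
    (simp_all add: twist_free_single scal_mult_single twist_free_add ring_distribs mult_ac)

text \<open>The cocycle law \<open>word_scalar_append\<close>, extended linearly in the left factor. The right factor has to be
  homogeneous for a single weight to appear on the left.\<close>

lemma twist_free_mult_single:
  "twist_free \<Omega> D s \<mu> (x * Poly_Mapping.single w c)
     = twist_free \<Omega> D s (\<mu> + word_wt (letters w)) x * twist_free \<Omega> D s \<mu> (Poly_Mapping.single w c)"
  by (induction x rule: free_alg_additive_induct)
    (simp_all add: twist_free_single mult_single plus_word_def word_scalar_append twist_free_add
      ring_distribs mult_ac)

lemma twist_free_1 [simp]: "twist_free \<Omega> D s \<mu> 1 = 1"
  using twist_free_single[of \<Omega> D s \<mu> 0 1] by (simp add: zero_word_def flip: single_one)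

lemma twist_free_scal [simp]: "twist_free \<Omega> D s \<mu> (scal c) = scal c"
  using twist_free_scal_mult[of \<Omega> D s \<mu> c 1] by simp

lemma twist_free_letter:
  "twist_free \<Omega> D s \<mu> (letter g) = scal (gen_scalar \<Omega> D s \<mu> g) * letter g"
  by (simp add: letter_def twist_free_single scal_mult_single word_wt_def)

lemma twist_free_mult_letter:
  "twist_free \<Omega> D s \<mu> (x * letter g) =
     scal (gen_scalar \<Omega> D s \<mu> g) * (twist_free \<Omega> D s (\<mu> + gen_wt g) x * letter g)"
  using twist_free_mult_single[of \<Omega> D s \<mu> x "Word [g]" 1]
  by (simp add: word_wt_def scal_left_commute flip: letter_def twist_free_letter)
     (simp add: twist_free_letter scal_left_commute)

locale cartan_lattice = finite_cartan_datum \<Omega> + admissible_lattice L + common_denominator \<Omega> L D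
  for \<Omega> :: "'i::finite \<Rightarrow> 'i \<Rightarrow> int" and L :: "(rat ^ 'i) set" and D :: nat
begin

lemma simple_root_in_L [simp, intro]: "simple_root i \<in> L"
  using root_lattice_subset by (auto simp: root_lattice_def simple_root_def axis_def)

lemma gen_wt_in_L [simp, intro]: "gen_wt g \<in> L"
  by (cases g) (auto simp: zero_mem minus_mem)

lemma diff_in_L [simp, intro]: "a \<in> L \<Longrightarrow> b \<in> L \<Longrightarrow> a - b \<in> L"
  using add_mem[of a "- b"] minus_mem[of b] by simp

lemma add_in_L [simp, intro]: "a \<in> L \<Longrightarrow> b \<in> L \<Longrightarrow> a + b \<in> L"
  by (rule add_mem)

lemma word_wt_in_L [simp, intro]: "word_wt gs \<in> L"
  by (induction gs) (auto simp: word_wt_def zero_mem)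

lemma eform_exponent [simp, intro]: "a \<in> L \<Longrightarrow> b \<in> L \<Longrightarrow> eform \<Omega> a b \<in> exponents D"
  by (simp add: exponents_def D_eform)

lemma sform_exponent [simp, intro]: "a \<in> L \<Longrightarrow> b \<in> L \<Longrightarrow> sform \<Omega> a b \<in> exponents D"
  by (simp add: exponents_def D_sform)

lemma gen_exponent_exponent [simp, intro]: "\<mu> \<in> L \<Longrightarrow> gen_exponent \<Omega> \<mu> g \<in> exponents D"
  by (cases g) (auto simp: cartan_exponent_def)

end

section \<open>Twisting the relators\<close>

text \<open>The twist by \<open>s\<close> leads from parameter \<open>y\<close> to parameter \<open>y * s\<close>. It is applied with \<open>y = 1\<close> and
  \<open>s = t\<close>, and with \<open>y = t\<close> and \<open>s\<close> the inverse of \<open>t\<close>, each time on the level of \<open>D\<close>-th roots.\<close>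

locale twist = cartan_lattice \<Omega> L D
  for \<Omega> :: "'i::finite \<Rightarrow> 'i \<Rightarrow> int" and L :: "(rat ^ 'i) set" and D :: nat +
  fixes y s :: ratfun
  assumes y_nonzero [simp]: "y \<noteq> 0" and s_nonzero [simp]: "s \<noteq> 0"
begin

abbreviation "gs \<equiv> gen_scalar \<Omega> D s"
abbreviation "\<Theta> \<equiv> twist_free \<Omega> D s"

lemma gen_scalar_shift:
  assumes "\<mu> \<in> L" and "gen_exponent \<Omega> (\<mu> + \<nu>) g = gen_exponent \<Omega> \<mu> g + q" and "q \<in> exponents D"
  shows "gs (\<mu> + \<nu>) g = gs \<mu> g * fpow D s q"
  using assms by (simp add: gen_scalar_def fpow_add)

lemma gen_scalar_replicate:
  assumes "\<And>\<nu>. \<nu> \<in> L \<Longrightarrow> gs (\<nu> + gen_wt g) h = gs \<nu> h * P" and "\<mu> \<in> L"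
  shows "gs (\<mu> + word_wt (replicate n g)) h = gs \<mu> h * P ^ n"
  using assms(2)
proof (induction n arbitrary: \<mu>)
  case (Suc n)
  have "\<mu> + word_wt (replicate (Suc n) g) = (\<mu> + gen_wt g) + word_wt (replicate n g)"
    by (simp add: word_wt_def add.assoc)
  then have "gs (\<mu> + word_wt (replicate (Suc n) g)) h = gs (\<mu> + gen_wt g) h * P ^ n"
    using Suc by (simp only: gen_wt_in_L add_in_L)
  then show ?case
    using Suc.prems by (simp add: assms(1))
qed (simp add: word_wt_def)

text \<open>Each application of the letter \<open>g\<close> multiplies the scalar of the next one by \<open>T\<close>, so that \<open>n\<close> applications
  contribute \<open>T\<close> to the power \<open>0 + 1 + \<dots> + (n - 1)\<close>.\<close>

lemma twist_free_mult_letter_power: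
  assumes shift: "\<And>\<nu>. \<nu> \<in> L \<Longrightarrow> gs (\<nu> + gen_wt g) g = gs \<nu> g * T" and "\<mu> \<in> L"
  shows "\<Theta> \<mu> (x * letter g ^ n) =
    scal (gs \<mu> g ^ n * T ^ (n choose 2))
      * (\<Theta> (\<mu> + word_wt (replicate n g)) x * letter g ^ n)"
proof (induction n arbitrary: x)
  case 0
  then show ?case by (simp add: word_wt_def numeral_2_eq_2)
next
  case (Suc n)
  have "\<Theta> \<mu> (x * letter g ^ Suc n) = \<Theta> \<mu> ((x * letter g) * letter g ^ n)"
    by (simp add: mult.assoc)
  also have "\<dots> = scal (gs \<mu> g ^ n * T ^ (n choose 2)) *
      (\<Theta> (\<mu> + word_wt (replicate n g)) (x * letter g) * letter g ^ n)"
    by (rule Suc)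
  also have "\<dots> = scal ((gs \<mu> g ^ n * T ^ (n choose 2)) * (gs \<mu> g * T ^ n)) *
      (\<Theta> (\<mu> + word_wt (replicate n g) + gen_wt g) x * letter g ^ Suc n)"
    by (simp add: twist_free_mult_letter gen_scalar_replicate[OF shift assms(2)] scal_mult mult.assoc)
  also have "\<mu> + word_wt (replicate n g) + gen_wt g = \<mu> + word_wt (replicate (Suc n) g)"
    by (simp add: word_wt_def add_ac)
  also have "(gs \<mu> g ^ n * T ^ (n choose 2)) * (gs \<mu> g * T ^ n) = gs \<mu> g ^ Suc n * T ^ (Suc n choose 2)"
    by (simp add: numeral_2_eq_2 power_add mult_ac)
  finally show ?case .
qed

text \<open>A letter that has acted multiplies the scalar of every later letter by a constant: \<open>T\<close> for \<open>g\<close> after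
  \<open>g\<close>, \<open>P\<close> for \<open>h\<close> after \<open>g\<close>, and \<open>S\<close> for \<open>g\<close> after \<open>h\<close>. There are \<open>(a + b) choose 2\<close> pairs of
  letters \<open>g\<close>, while \<open>h\<close> acts after \<open>b\<close> of them and before the other \<open>a\<close>.\<close>

lemma twist_free_serre_monomial:
  assumes g_g: "\<And>\<nu>. \<nu> \<in> L \<Longrightarrow> gs (\<nu> + gen_wt g) g = gs \<nu> g * T"
    and h_g: "\<And>\<nu>. \<nu> \<in> L \<Longrightarrow> gs (\<nu> + gen_wt g) h = gs \<nu> h * P"
    and g_h: "\<And>\<nu>. \<nu> \<in> L \<Longrightarrow> gs (\<nu> + gen_wt h) g = gs \<nu> g * S"
    and "\<mu> \<in> L"
  shows "\<Theta> \<mu> (letter g ^ a * letter h * letter g ^ b) =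
    scal (gs \<mu> g ^ (a + b) * gs \<mu> h * T ^ ((a + b) choose 2) * P ^ b * S ^ a)
      * (letter g ^ a * letter h * letter g ^ b)"
proof -
  define \<nu> where "\<nu> = \<mu> + word_wt (replicate b g)"
  have [simp]: "\<nu> \<in> L" using assms(4) by (simp add: \<nu>_def)
  have h: "gs \<nu> h = gs \<mu> h * P ^ b"
    unfolding \<nu>_def by (rule gen_scalar_replicate[OF h_g assms(4)])
  have g: "gs (\<nu> + gen_wt h) g = gs \<mu> g * T ^ b * S"
    by (simp add: g_h) (simp add: \<nu>_def gen_scalar_replicate[OF g_g assms(4)])
  have "\<Theta> (\<nu> + gen_wt h) (letter g ^ a) = scal ((gs \<mu> g * T ^ b * S) ^ a * T ^ (a choose 2)) * letter g ^ a"
    using twist_free_mult_letter_power[OF g_g, of "\<nu> + gen_wt h" 1 a] by (simp add: g)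
  then have "\<Theta> \<mu> (letter g ^ a * letter h * letter g ^ b) =
     scal ((gs \<mu> g ^ b * T ^ (b choose 2)) * (gs \<mu> h * P ^ b) * ((gs \<mu> g * T ^ b * S) ^ a * T ^ (a choose 2)))
      * (letter g ^ a * letter h * letter g ^ b)"
    by (simp add: twist_free_mult_letter_power[OF g_g assms(4)] twist_free_mult_letter h
      flip: \<nu>_def) (simp add: scal_mult mult.assoc)
  also have "(gs \<mu> g ^ b * T ^ (b choose 2)) * (gs \<mu> h * P ^ b) * ((gs \<mu> g * T ^ b * S) ^ a * T ^ (a choose 2))
    = gs \<mu> g ^ (a + b) * gs \<mu> h * T ^ ((a + b) choose 2) * P ^ b * S ^ a"
    by (simp add: choose_two_add power_add power_mult_distrib mult_ac flip: power_mult)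
  finally show ?thesis .
qed

lemma kappa_rescale:
  "kappa \<Omega> D (y * s) i j p q = kappa \<Omega> D y i j p q *
     (inverse (fpow D s (of_int (\<Omega> i i)) ^ (p * q)) * fpow D s (of_int (\<Omega> i j)) ^ p
       * inverse (fpow D s (of_int (\<Omega> j i)) ^ p))"
proof -
  have e: "(of_int (- (\<Omega> i i * int p * int q) + int p * \<Omega> i j - int p * \<Omega> j i) :: rat)
    = of_nat p * of_int (\<Omega> i j) - of_nat (p * q) * of_int (\<Omega> i i) - of_nat p * of_int (\<Omega> j i)"
    by simp
  have "fpow D s (of_int (- (\<Omega> i i * int p * int q) + int p * \<Omega> i j - int p * \<Omega> j i)) =
    fpow D s (of_int (\<Omega> i j)) ^ p * inverse (fpow D s (of_int (\<Omega> i i)) ^ (p * q))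
       * inverse (fpow D s (of_int (\<Omega> j i)) ^ p)"
    unfolding e
    by (subst fpow_diff fpow_of_nat_mult; (intro exponents_diff exponents_of_nat_mult exponents_of_int s_nonzero)?)+ simp
  then show ?thesis
    unfolding kappa_def by (simp only: fpow_base_mult mult_ac)
qed

text \<open>The coefficient of a Serre monomial once the divided powers are expanded.\<close>

definition serre_coeff :: "ratfun \<Rightarrow> 'i \<Rightarrow> 'i \<Rightarrow> nat \<Rightarrow> nat \<Rightarrow> ratfun" where
  "serre_coeff x i j p q = kappa \<Omega> D x i j p q
     * inverse (qfact (v_pow D (of_int (\<Omega> i i))) (fpow D x (of_int (\<Omega> i i))) p)
     * inverse (qfact (v_pow D (of_int (\<Omega> i i))) (fpow D x (of_int (\<Omega> i i))) q)"

text \<open>The combined factor of coefficient and monomial depends on \<open>p + q\<close> only. The inverse factorials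
  contribute \<open>T\<close> to the power \<open>- (p choose 2) - (q choose 2)\<close>, which is \<open>- ((p + q) choose 2) + p * q\<close>; the
  first part cancels against the monomial and the second against \<open>kappa\<close>, which also turns \<open>R ^ p\<close> into
  \<open>Q ^ p\<close>.\<close>

lemma serre_coeff_rescale:
  fixes i j
  defines "T \<equiv> fpow D s (of_int (\<Omega> i i))" and "Q \<equiv> fpow D s (of_int (\<Omega> i j))"
    and "R \<equiv> fpow D s (of_int (\<Omega> j i))"
  shows "serre_coeff (y * s) i j p q * (A ^ (p + q) * B * T ^ ((p + q) choose 2) * Q ^ q * R ^ p)
    = (A ^ (p + q) * B * Q ^ (p + q)) * serre_coeff y i j p q"
proof -
  have nz: "T \<noteq> 0" "Q \<noteq> 0" "R \<noteq> 0" by (simp_all add: T_def Q_def R_def)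
  have qf: "qfact v (fpow D (y * s) (of_int (\<Omega> i i))) n
      = T ^ (n choose 2) * qfact v (fpow D y (of_int (\<Omega> i i))) n" for v n
    unfolding fpow_base_mult T_def by (rule qfact_rescale) simp
  have cancel: "k * (inverse c * u * inverse r) * inverse (a * f) * inverse (b * g)
      * (X * (a * b * c) * w * r) = (X * (u * w)) * (k * inverse f * inverse g)"
    if "a \<noteq> 0" "b \<noteq> 0" "c \<noteq> 0" "r \<noteq> 0" for k c u r a f b g X w :: ratfun
    using that by (simp add: divide_simps)
  show ?thesis
    unfolding serre_coeff_def qf kappa_rescale choose_two_add power_add[of T] power_add[of Q]
    unfolding T_def[symmetric] Q_def[symmetric] R_def[symmetric]
    by (rule cancel) (use nz in simp_all)
qed

lemma serre_E_eq:
  "serre_E \<Omega> D x i j = (let N = nat (1 - cartan_entry \<Omega> i j) in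
     \<Sum>p\<le>N. scal (serre_coeff x i j p (N - p)) * (letter (GE i) ^ p * letter (GE j) * letter (GE i) ^ (N - p)))"
  by (simp only: serre_E_def divpow_def serre_coeff_def scal_collect)

lemma serre_F_eq:
  "serre_F \<Omega> D x i j = (let N = nat (1 - cartan_entry \<Omega> i j) in
     \<Sum>p\<le>N. scal (serre_coeff x i j p (N - p)) * (letter (GF i) ^ (N - p) * letter (GF j) * letter (GF i) ^ p))"
  unfolding serre_F_def divpow_def serre_coeff_def scal_collect by (simp only: mult_ac)

lemma twist_free_serre_sum:
  fixes i j N \<mu>
  defines "T \<equiv> fpow D s (of_int (\<Omega> i i))" and "Q \<equiv> fpow D s (of_int (\<Omega> i j))"
    and "R \<equiv> fpow D s (of_int (\<Omega> j i))"
  assumes "\<And>p. p \<le> N \<Longrightarrow> \<Theta> \<mu> (m p) = scal (A ^ N * B * T ^ (N choose 2) * Q ^ (N - p) * R ^ p) * m p"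
  shows "\<Theta> \<mu> (\<Sum>p\<le>N. scal (serre_coeff (y * s) i j p (N - p)) * m p) =
    scal (A ^ N * B * Q ^ N) * (\<Sum>p\<le>N. scal (serre_coeff y i j p (N - p)) * m p)"
proof -
  have "scal (serre_coeff (y * s) i j p (N - p)) * \<Theta> \<mu> (m p) =
      scal (A ^ N * B * Q ^ N) * (scal (serre_coeff y i j p (N - p)) * m p)" if "p \<le> N" for p
  proof -
    have "serre_coeff (y * s) i j p (N - p) * (A ^ N * B * T ^ (N choose 2) * Q ^ (N - p) * R ^ p)
        = (A ^ N * B * Q ^ N) * serre_coeff y i j p (N - p)"
      using serre_coeff_rescale[of i j p "N - p" A B] unfolding T_def Q_def R_def
      by (simp only: le_add_diff_inverse[OF that])
    then show ?thesis
      by (simp only: assms(4)[OF that] scal_scal_mult)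
  qed
  then show ?thesis
    by (simp add: twist_free_sum twist_free_scal_mult sum_distrib_left)
qed

lemma twist_free_serre_E:
  assumes "\<mu> \<in> L"
  shows "\<exists>C. \<Theta> \<mu> (serre_E \<Omega> D (y * s) i j) = scal C * serre_E \<Omega> D y i j"
proof -
  have shift: "gs (\<nu> + gen_wt (GE k)) (GE l) = gs \<nu> (GE l) * fpow D s (of_int (\<Omega> k l))"
    if "\<nu> \<in> L" for \<nu> k l
    using that by (intro gen_scalar_shift) (simp_all add: eform_add_left eform_simple_root)
  show ?thesis
    unfolding serre_E_eq Let_def
    by (rule exI, rule twist_free_serre_sum[where A = "gs \<mu> (GE i)" and B = "gs \<mu> (GE j)"])
      (simp add: twist_free_serre_monomial[OF shift shift shift assms])
qed

text \<open>For the \<open>F\<close> the exponents \<open>p\<close> and \<open>N - p\<close> trade places in the monomial, and so do the two shift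
  constants, so the scalars are those of the \<open>E\<close>.\<close>

lemma twist_free_serre_F:
  assumes "\<mu> \<in> L"
  shows "\<exists>C. \<Theta> \<mu> (serre_F \<Omega> D (y * s) i j) = scal C * serre_F \<Omega> D y i j"
proof -
  have shift: "gs (\<nu> + gen_wt (GF k)) (GF l) = gs \<nu> (GF l) * fpow D s (of_int (\<Omega> l k))"
    if "\<nu> \<in> L" for \<nu> k l
    using that by (intro gen_scalar_shift) (simp_all add: eform_add_right eform_uminus_right eform_simple_root
      flip: add_uminus_conv_diff)
  show ?thesis
    unfolding serre_F_eq Let_def
    by (rule exI, rule twist_free_serre_sum[where A = "gs \<mu> (GF i)" and B = "gs \<mu> (GF j)"])
      (simp add: twist_free_serre_monomial[OF shift shift shift assms], simp add: mult_ac)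
qed

text \<open>The core of the theorem: every relator is homogeneous for the twist, up to the change of parameter in
  its coefficients.\<close>

lemma twist_free_relator:
  assumes "\<mu> \<in> L" and "r \<in> relators \<Omega> D (y * s)"
  shows "\<exists>C. \<exists>r'\<in>relators \<Omega> D y. \<Theta> \<mu> r = scal C * r'"
proof -
  let ?good = "\<lambda>r. \<exists>C. \<exists>r'\<in>relators \<Omega> D y. \<Theta> \<mu> r = scal C * r'"
  have goodI: "?good r" if "r' \<in> relators \<Omega> D y" "\<Theta> \<mu> r = scal C * r'" for r r' C
    using that by blast

  have inv: "gs \<mu> (GK_inv i) = inverse (gs \<mu> (GK i))" "gs \<mu> (GK'_inv i) = inverse (gs \<mu> (GK' i))" for i
    using assms(1) gen_exponent_exponent[OF assms(1), of "GK i"]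
    by (simp_all add: gen_scalar_def fpow_uminus)
  \<comment> \<open>How the scalar of one generator changes when another generator has acted before.\<close>
  have E: "gs (\<mu> + simple_root j) (GK i) = gs \<mu> (GK i) * fpow D s (of_int (\<Omega> j i - \<Omega> i j))"
    "gs (\<mu> + simple_root j) (GK' i) = gs \<mu> (GK' i) * fpow D s (of_int (\<Omega> j i - \<Omega> i j))" for i j
    using assms(1) exponents_of_int[of "\<Omega> j i - \<Omega> i j" D]
    by (auto intro!: gen_scalar_shift
        simp: eform_add_left eform_add_right eform_simple_root cartan_exponent_def)
  have F: "gs (\<mu> + - simple_root j) (GK i) = gs \<mu> (GK i) * fpow D s (of_int (\<Omega> i j - \<Omega> j i))"
    "gs (\<mu> + - simple_root j) (GK' i) = gs \<mu> (GK' i) * fpow D s (of_int (\<Omega> i j - \<Omega> j i))" for i j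
    using assms(1) exponents_of_int[of "\<Omega> i j - \<Omega> j i" D]
    by (auto intro!: gen_scalar_shift simp del: add_uminus_conv_diff
        simp: eform_add_left eform_add_right eform_uminus_left eform_uminus_right
          eform_simple_root cartan_exponent_def)
  have EF: "gs (\<mu> + simple_root i) (GF j) = gs \<mu> (GF j) * fpow D s (of_int (- \<Omega> j i))"
    "gs (\<mu> + - simple_root j) (GE i) = gs \<mu> (GE i) * fpow D s (of_int (- \<Omega> j i))" for i j
    using assms(1) exponents_of_int[of "- \<Omega> j i" D]
    by (auto intro!: gen_scalar_shift simp del: add_uminus_conv_diff
        simp: eform_add_left eform_add_right eform_uminus_left eform_uminus_right eform_simple_root)
  \<comment> \<open>This is why \<open>d\<^sub>i\<close> occurs in the formula for \<open>F\<^sub>i\<close>: it offsets the shift by \<open>\<Omega>\<^sub>i\<^sub>i\<close>.\<close>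
  have EFK: "gs \<mu> (GE i) * (gs \<mu> (GF i) * fpow D s (of_int (- \<Omega> i i))) = gs \<mu> (GK i)" for i
  proof -
    have "gs \<mu> (GK i) = fpow D s (gen_exponent \<Omega> \<mu> (GE i) + (gen_exponent \<Omega> \<mu> (GF i) + of_int (- \<Omega> i i)))"
      by (simp add: gen_scalar_def cartan_exponent_def)
    also have "\<dots> = gs \<mu> (GE i) * (gs \<mu> (GF i) * fpow D s (of_int (- \<Omega> i i)))"
      by (simp add: gen_scalar_def fpow_add exponents_add assms(1) del: gen_exponent.simps of_int_minus)
    finally show ?thesis ..
  qed
  have K': "gs \<mu> (GK' i) = gs \<mu> (GK i)" for i
    by (simp add: gen_scalar_def)

  note twist_simps = twist_free_diff twist_free_mult_letter twist_free_letter twist_free_scal_mult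
    scal_scal_mult scal_left_commute[of "letter _"] mult.assoc

  have inverse: "?good (letter f * letter g - 1)"
    if "letter f * letter g - 1 \<in> relators \<Omega> D y" "gen_wt g = 0" "gs \<mu> g * gs \<mu> f = 1" for f g
    by (rule goodI[where C = 1, OF that(1)]) (simp add: twist_simps that)
  have inverses: "?good (letter (GK i) * letter (GK_inv i) - 1)"
    "?good (letter (GK_inv i) * letter (GK i) - 1)"
    "?good (letter (GK' i) * letter (GK'_inv i) - 1)"
    "?good (letter (GK'_inv i) * letter (GK' i) - 1)" for i
    by (rule inverse; simp add: relators_inverse inv)+

  have commute: "?good (letter f * letter g - letter g * letter f)"
    if "letter f * letter g - letter g * letter f \<in> relators \<Omega> D y" "gen_wt f = 0" "gen_wt g = 0" for f g
    by (rule goodI[where C = "gs \<mu> f * gs \<mu> g", OF that(1)])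
      (simp add: twist_simps that right_diff_distrib mult.commute)
  have commutes: "?good (letter (GK i) * letter (GK j) - letter (GK j) * letter (GK i))"
    "?good (letter (GK i) * letter (GK' j) - letter (GK' j) * letter (GK i))"
    "?good (letter (GK' i) * letter (GK' j) - letter (GK' j) * letter (GK' i))" for i j
    by (rule commute; simp add: relators_commute)+

  have conj: "?good (letter f * letter g * letter h - scal (c * fpow D (y * s) (of_int k)) * letter g)"
    if "letter f * letter g * letter h - scal (c * fpow D y (of_int k)) * letter g \<in> relators \<Omega> D y"
      and "gen_wt h = 0" and "gs \<mu> h * gs (\<mu> + gen_wt g) f = fpow D s (of_int k)" for f g h c k
  proof (rule goodI[OF that(1)])
    have "\<Theta> \<mu> (letter f * letter g * letter h) =
        scal (gs \<mu> h * gs \<mu> g * gs (\<mu> + gen_wt g) f) * (letter f * letter g * letter h)"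
      by (simp add: twist_free_mult_letter twist_free_letter that(2))
        (simp add: scal_scal_mult scal_left_commute[of "letter _"] mult.assoc mult_ac(2,3)[where ?'a = ratfun])
    also have "gs \<mu> h * gs \<mu> g * gs (\<mu> + gen_wt g) f = gs \<mu> g * fpow D s (of_int k)"
      by (simp add: that(3)[symmetric] mult_ac)
    finally show "\<Theta> \<mu> (letter f * letter g * letter h - scal (c * fpow D (y * s) (of_int k)) * letter g) =
      scal (gs \<mu> g * fpow D s (of_int k))
        * (letter f * letter g * letter h - scal (c * fpow D y (of_int k)) * letter g)"
      by (simp add: twist_free_diff twist_free_scal_mult twist_free_letter scal_scal_mult
          fpow_base_mult right_diff_distrib mult_ac(2,3)[where ?'a = ratfun])
  qed
  have E_conj: "gs \<mu> (GK_inv i) * gs (\<mu> + gen_wt (GE j)) (GK i) = fpow D s (of_int (\<Omega> j i - \<Omega> i j))"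
    "gs \<mu> (GK'_inv i) * gs (\<mu> + gen_wt (GE j)) (GK' i) = fpow D s (of_int (\<Omega> j i - \<Omega> i j))" for i j
    by (simp_all add: E inv)
  have F_conj: "gs \<mu> (GK_inv i) * gs (\<mu> + gen_wt (GF j)) (GK i) = fpow D s (of_int (\<Omega> i j - \<Omega> j i))"
    "gs \<mu> (GK'_inv i) * gs (\<mu> + gen_wt (GF j)) (GK' i) = fpow D s (of_int (\<Omega> i j - \<Omega> j i))" for i j
    by (simp_all add: F[simplified] inv)
  note conjugations = conj[OF relators_conjugation(1) _ E_conj(1)] conj[OF relators_conjugation(2) _ E_conj(2)]
    conj[OF relators_conjugation(3) _ F_conj(1)] conj[OF relators_conjugation(4) _ F_conj(2)]

  have cross: "?good (letter (GE i) * letter (GF j) - letter (GF j) * letter (GE i)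
      - (if i = j then scal (inverse (v_pow D (of_int (\<Omega> i i)) - inverse (v_pow D (of_int (\<Omega> i i)))))
           * (letter (GK i) - letter (GK' i)) else 0))" for i j
    by (rule goodI[where C = "gs \<mu> (GE i) * (gs \<mu> (GF j) * fpow D s (of_int (- \<Omega> j i)))",
          OF relators_cross[of i j]], cases "i = j")
      (simp_all add: twist_simps EF[simplified] EFK[simplified] K' right_diff_distrib mult_ac)

  have serre: "?good (serre_E \<Omega> D (y * s) i j)" "?good (serre_F \<Omega> D (y * s) i j)" if "j \<in> - {i}" for i j
    using twist_free_serre_E[OF assms(1), of i j] twist_free_serre_F[OF assms(1), of i j]
      relators_serre[OF that, of \<Omega> D y] by blast+

  from assms(2) show ?thesis
    unfolding relators_def[of _ _ "y * s"]
    by (elim UnE UN_E insertE emptyE; hypsubst)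
      (rule inverses commutes cross | erule serre | rule conjugations gen_wt.simps)+
qed

end


section \<open>Weight modules\<close>

lemma add_monoid_act_update [simp]: "add_monoid (M\<lparr>act := a\<rparr>) = add_monoid M"
  by simp

lemma finsum_act_update [simp]: "finsum (M\<lparr>act := a\<rparr>) = finsum M"
  by (simp add: finsum_def fun_eq_iff)

lemma module_act_update [simp]: "Module.module R (M\<lparr>act := a\<rparr>) \<longleftrightarrow> Module.module R M"
  by (simp add: Module.module_def module_axioms_def abelian_group_def abelian_monoid_def
      abelian_group_axioms_def)

lemma submodule_act_update [simp]: "submodule H R (M\<lparr>act := a\<rparr>) \<longleftrightarrow> submodule H R M"
  by (simp add: submodule_def submodule_axioms_def)

lemma weight_decomposition_act_update [simp]:
  "weight_decomposition L (M\<lparr>act := a\<rparr>) \<longleftrightarrow> weight_decomposition L M"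
  by (simp add: weight_decomposition_def)

lemma fin_dim_act_update [simp]: "fin_dim (M\<lparr>act := a\<rparr>) \<longleftrightarrow> fin_dim M"
  by (simp add: fin_dim_def)

locale graded_space = Module.module ground_ring M for M :: "('i::finite, 'm) wmod" (structure) +
  fixes L :: "(rat ^ 'i) set"
  assumes weight_decomposition: "weight_decomposition L M"
begin

text \<open>The components of \<open>m\<close> in the weight spaces. Indices outside \<open>L\<close> carry the zero vector, since
  nothing is known about the sets that \<open>wt\<close> assigns to them.\<close>

definition weight_family :: "'m \<Rightarrow> (rat ^ 'i \<Rightarrow> 'm) \<Rightarrow> bool" where
  "weight_family m f \<longleftrightarrow> (\<forall>\<mu>\<in>L. f \<mu> \<in> wt M \<mu>) \<and> (\<forall>\<mu>. \<mu> \<notin> L \<longrightarrow> f \<mu> = \<zero>) \<and>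
     finite {\<mu>. f \<mu> \<noteq> \<zero>} \<and> m = (\<Oplus>\<mu>\<in>{\<mu>. f \<mu> \<noteq> \<zero>}. f \<mu>)"

lemma weight_family_ex1: "m \<in> carrier M \<Longrightarrow> \<exists>!f. weight_family m f"
  using weight_decomposition by (simp add: weight_decomposition_def weight_family_def)

lemma wt_submodule: "\<mu> \<in> L \<Longrightarrow> submodule (wt M \<mu>) ground_ring M"
  using weight_decomposition by (simp add: weight_decomposition_def)

lemma wt_subset [intro]: "\<mu> \<in> L \<Longrightarrow> m \<in> wt M \<mu> \<Longrightarrow> m \<in> carrier M"
  using submoduleE(1)[OF wt_submodule] by blast

lemma wt_add: "\<mu> \<in> L \<Longrightarrow> m \<in> wt M \<mu> \<Longrightarrow> n \<in> wt M \<mu> \<Longrightarrow> m \<oplus> n \<in> wt M \<mu>"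
  using submoduleE(5)[OF wt_submodule] by blast

lemma wt_smult: "\<mu> \<in> L \<Longrightarrow> m \<in> wt M \<mu> \<Longrightarrow> c \<odot>\<^bsub>M\<^esub> m \<in> wt M \<mu>"
  using submoduleE(4)[OF wt_submodule] by simp

lemma wt_zero: "\<mu> \<in> L \<Longrightarrow> \<zero> \<in> wt M \<mu>"
  using wt_submodule[THEN submodule.axioms(1), THEN subgroup.one_closed] by simp

lemma weight_family_closed: "weight_family m f \<Longrightarrow> f \<mu> \<in> carrier M"
  by (cases "\<mu> \<in> L") (auto simp: weight_family_def)

lemma finsum_support:
  assumes "finite A" "{\<mu>. f \<mu> \<noteq> \<zero>} \<subseteq> A" "\<And>\<mu>. f \<mu> \<in> carrier M"
  shows "(\<Oplus>\<mu>\<in>{\<mu>. f \<mu> \<noteq> \<zero>}. f \<mu>) = (\<Oplus>\<mu>\<in>A. f \<mu>)"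
  by (rule add.finprod_mono_neutral_cong_left) (use assms in auto)

lemma weight_family_add:
  assumes "weight_family m f" "weight_family n h"
  shows "weight_family (m \<oplus> n) (\<lambda>\<mu>. f \<mu> \<oplus> h \<mu>)"
proof -
  define A where "A = {\<mu>. f \<mu> \<noteq> \<zero>} \<union> {\<mu>. h \<mu> \<noteq> \<zero>}"
  have [simp]: "finite A"
    using assms by (simp add: A_def weight_family_def)
  note closed [simp] = weight_family_closed[OF assms(1)] weight_family_closed[OF assms(2)]
  have sub: "{\<mu>. f \<mu> \<oplus> h \<mu> \<noteq> \<zero>} \<subseteq> A"
    by (auto simp: A_def)
  have "m \<oplus> n = (\<Oplus>\<mu>\<in>A. f \<mu>) \<oplus> (\<Oplus>\<mu>\<in>A. h \<mu>)"
    using assms finsum_support[of A f] finsum_support[of A h]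
    by (auto simp: weight_family_def A_def)
  also have "\<dots> = (\<Oplus>\<mu>\<in>A. f \<mu> \<oplus> h \<mu>)"
    by (simp add: finsum_addf)
  also have "\<dots> = (\<Oplus>\<mu>\<in>{\<mu>. f \<mu> \<oplus> h \<mu> \<noteq> \<zero>}. f \<mu> \<oplus> h \<mu>)"
    using sub by (intro finsum_support[symmetric]) auto
  finally show ?thesis
    using assms finite_subset[OF sub] by (auto simp: weight_family_def wt_add)
qed

lemma weight_family_homogeneous:
  assumes "\<mu> \<in> L" "m \<in> wt M \<mu>"
  shows "weight_family m (\<lambda>\<nu>. if \<nu> = \<mu> then m else \<zero>)"
proof -
  have [simp]: "m \<in> carrier M" using assms by auto
  have "(\<Oplus>\<nu>\<in>{\<nu>. (if \<nu> = \<mu> then m else \<zero>) \<noteq> \<zero>}. if \<nu> = \<mu> then m else \<zero>)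
      = (\<Oplus>\<nu>\<in>{\<mu>}. if \<nu> = \<mu> then m else \<zero>)"
    by (rule finsum_support) auto
  then show ?thesis
    using assms by (auto simp: weight_family_def wt_zero)
qed

lemma weight_induct [consumes 1, case_names zero weight add]:
  assumes "m \<in> carrier M" and zero: "P \<zero>"
    and weight: "\<And>\<mu> m. \<mu> \<in> L \<Longrightarrow> m \<in> wt M \<mu> \<Longrightarrow> P m"
    and add: "\<And>m n. m \<in> carrier M \<Longrightarrow> n \<in> carrier M \<Longrightarrow> P m \<Longrightarrow> P n \<Longrightarrow> P (m \<oplus> n)"
  shows "P m"
proof -
  obtain f where f: "weight_family m f"
    using weight_family_ex1[OF assms(1)] by auto
  note closed [simp] = weight_family_closed[OF f]
  have P_f: "P (f \<mu>)" for \<mu>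
    using f zero weight by (cases "\<mu> \<in> L") (auto simp: weight_family_def)
  have "P (\<Oplus>\<mu>\<in>A. f \<mu>)" if "finite A" for A
    using that by induction (simp_all add: zero add finsum_closed P_f)
  then show ?thesis
    using f by (auto simp: weight_family_def)
qed

text \<open>The universal property of the direct sum of the weight spaces, for maps of abelian groups. Scalars
  enter later, through the action of the constants of the free algebra.\<close>

lemma additive_extension:
  fixes g :: "rat ^ 'i \<Rightarrow> 'm \<Rightarrow> 'm"
  assumes g_closed: "\<And>\<mu> m. \<mu> \<in> L \<Longrightarrow> m \<in> wt M \<mu> \<Longrightarrow> g \<mu> m \<in> carrier M"
    and g_add: "\<And>\<mu> m n. \<mu> \<in> L \<Longrightarrow> m \<in> wt M \<mu> \<Longrightarrow> n \<in> wt M \<mu> \<Longrightarrow> g \<mu> (m \<oplus> n) = g \<mu> m \<oplus> g \<mu> n"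
  obtains G where "G \<in> carrier M \<rightarrow>\<^sub>E carrier M"
    and "\<And>m n. m \<in> carrier M \<Longrightarrow> n \<in> carrier M \<Longrightarrow> G (m \<oplus> n) = G m \<oplus> G n"
    and "\<And>\<mu> m. \<mu> \<in> L \<Longrightarrow> m \<in> wt M \<mu> \<Longrightarrow> G m = g \<mu> m"
proof
  have g_zero: "g \<mu> \<zero> = \<zero>" if "\<mu> \<in> L" for \<mu>
  proof -
    have "g \<mu> \<zero> = g \<mu> \<zero> \<oplus> g \<mu> \<zero>"
      using g_add[OF that wt_zero[OF that] wt_zero[OF that]] by simp
    then show ?thesis
      using g_closed[OF that wt_zero[OF that]] by (metis add.r_cancel_one')
  qed
  define g' where "g' f \<mu> = (if \<mu> \<in> L then g \<mu> (f \<mu>) else \<zero>)" for f :: "rat ^ 'i \<Rightarrow> 'm" and \<mu>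
  define G where "G = restrict (\<lambda>m. \<Oplus>\<mu>\<in>{\<mu>. g' (THE f. weight_family m f) \<mu> \<noteq> \<zero>}. g' (THE f. weight_family m f) \<mu>) (carrier M)"
  have g'_closed: "g' f \<mu> \<in> carrier M" if "weight_family m f" for m f \<mu>
    using that by (auto simp: g'_def weight_family_def g_closed)
  have g'_support: "{\<mu>. g' f \<mu> \<noteq> \<zero>} \<subseteq> {\<mu>. f \<mu> \<noteq> \<zero>}" for f
    by (auto simp: g'_def g_zero)
  have G_eq: "G m = (\<Oplus>\<mu>\<in>A. g' f \<mu>)"
    if "m \<in> carrier M" "weight_family m f" "finite A" "{\<mu>. f \<mu> \<noteq> \<zero>} \<subseteq> A" for m f A
  proof -
    have "(THE f. weight_family m f) = f"
      using weight_family_ex1[OF that(1)] that(2) by (metis the1_equality)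
    then show ?thesis
      using that finsum_support[of A "g' f"] g'_closed[OF that(2)] g'_support[of f]
      by (auto simp: G_def)
  qed
  show "G \<in> carrier M \<rightarrow>\<^sub>E carrier M"
  proof (rule PiE_I)
    fix m assume m: "m \<in> carrier M"
    then obtain f where f: "weight_family m f"
      using weight_family_ex1 by blast
    then show "G m \<in> carrier M"
      using G_eq[OF m f _ order_refl] by (auto simp: weight_family_def intro!: finsum_closed g'_closed[OF f])
  qed (simp add: G_def)
  show "G (m \<oplus> n) = G m \<oplus> G n" if mn: "m \<in> carrier M" "n \<in> carrier M" for m n
  proof -
    obtain f h where fh: "weight_family m f" "weight_family n h"
      using ex1_implies_ex[OF weight_family_ex1[OF mn(1)]] ex1_implies_ex[OF weight_family_ex1[OF mn(2)]]
      by blast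
    define A where "A = {\<mu>. f \<mu> \<noteq> \<zero>} \<union> {\<mu>. h \<mu> \<noteq> \<zero>}"
    have A: "finite A" using fh by (auto simp: A_def weight_family_def)
    have "G (m \<oplus> n) = (\<Oplus>\<mu>\<in>A. g' (\<lambda>\<mu>. f \<mu> \<oplus> h \<mu>) \<mu>)"
      using mn A by (intro G_eq weight_family_add fh) (auto simp: A_def)
    also have "\<dots> = (\<Oplus>\<mu>\<in>A. g' f \<mu> \<oplus> g' h \<mu>)"
      using fh g'_closed[OF fh(1)] g'_closed[OF fh(2)]
      by (intro finsum_cong') (auto simp: g'_def weight_family_def g_add)
    also have "\<dots> = (\<Oplus>\<mu>\<in>A. g' f \<mu>) \<oplus> (\<Oplus>\<mu>\<in>A. g' h \<mu>)"
      using g'_closed[OF fh(1)] g'_closed[OF fh(2)] by (simp add: finsum_addf)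
    also have "(\<Oplus>\<mu>\<in>A. g' f \<mu>) = G m"
      using mn fh A by (intro G_eq[symmetric]) (auto simp: A_def)
    also have "(\<Oplus>\<mu>\<in>A. g' h \<mu>) = G n"
      using mn fh A by (intro G_eq[symmetric]) (auto simp: A_def)
    finally show ?thesis .
  qed
  show "G m = g \<mu> m" if "\<mu> \<in> L" "m \<in> wt M \<mu>" for \<mu> m
  proof -
    have "G m = (\<Oplus>\<nu>\<in>{\<mu>}. g' (\<lambda>\<nu>. if \<nu> = \<mu> then m else \<zero>) \<nu>)"
      using that by (intro G_eq weight_family_homogeneous) auto
    then show ?thesis
      using that g_closed by (simp add: g'_def)
  qed
qed

end

sublocale U_module \<subseteq> Module.module ground_ring M
  by (rule vector_space)

context U_module
begin

abbreviation rep :: "'i free_alg \<Rightarrow> 'm \<Rightarrow> 'm" where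
  "rep x \<equiv> act M (U_class \<Omega> D y x)"

lemma rep_closed [simp, intro]: "m \<in> carrier M \<Longrightarrow> rep x m \<in> carrier M"
  using act_closed by (auto simp: PiE_iff Pi_iff)

lemma rep_add: "m \<in> carrier M \<Longrightarrow> rep (a + b) m = rep a m \<oplus>\<^bsub>M\<^esub> rep b m"
  by (simp add: U_class_add act_add_left)

lemma rep_mult: "m \<in> carrier M \<Longrightarrow> rep (a * b) m = rep a (rep b m)"
  by (simp add: U_class_mult act_mult)

lemma rep_scal: "m \<in> carrier M \<Longrightarrow> rep (scal c) m = c \<odot>\<^bsub>M\<^esub> m"
  by (rule act_scal)

lemma rep_1: "m \<in> carrier M \<Longrightarrow> rep 1 m = m"
  by (simp add: U_class_one act_one)

lemma rep_0: "m \<in> carrier M \<Longrightarrow> rep 0 m = \<zero>\<^bsub>M\<^esub>"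
  using rep_scal[of m 0] smult_l_null[of m] by simp

lemma rep_vector_add: "m \<in> carrier M \<Longrightarrow> n \<in> carrier M \<Longrightarrow> rep x (m \<oplus>\<^bsub>M\<^esub> n) = rep x m \<oplus>\<^bsub>M\<^esub> rep x n"
  by (simp add: act_add_right)

lemma rep_scal_mult: "m \<in> carrier M \<Longrightarrow> rep (scal c * x) m = c \<odot>\<^bsub>M\<^esub> rep x m"
  by (simp add: rep_mult rep_scal)

lemma rep_smult: "m \<in> carrier M \<Longrightarrow> rep x (c \<odot>\<^bsub>M\<^esub> m) = c \<odot>\<^bsub>M\<^esub> rep x m"
  using rep_scal_mult[of m c x] by (simp add: scal_commute rep_mult rep_scal)

lemma rep_vector_zero: "rep x \<zero>\<^bsub>M\<^esub> = \<zero>\<^bsub>M\<^esub>"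
proof -
  have "rep x \<zero>\<^bsub>M\<^esub> = 0 \<odot>\<^bsub>M\<^esub> rep x \<zero>\<^bsub>M\<^esub>"
    using rep_smult[of "\<zero>\<^bsub>M\<^esub>" x 0] smult_r_null[of 0] by simp
  then show ?thesis
    using smult_l_null[of "rep x \<zero>\<^bsub>M\<^esub>"] by simp
qed

lemma rep_relator: "r \<in> relators \<Omega> D y \<Longrightarrow> m \<in> carrier M \<Longrightarrow> rep r m = \<zero>\<^bsub>M\<^esub>"
  by (simp add: U_class_relator rep_0)

lemma rep_GK_inverse:
  assumes "m \<in> carrier M"
  shows "rep (letter (GK i)) (rep (letter (GK_inv i)) m) = m"
    and "rep (letter (GK_inv i)) (rep (letter (GK i)) m) = m"
    and "rep (letter (GK' i)) (rep (letter (GK'_inv i)) m) = m"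
    and "rep (letter (GK'_inv i)) (rep (letter (GK' i)) m) = m"
proof -
  have 1: "rep (a * b) m = m" if "a * b - 1 \<in> relators \<Omega> D y" for a b
  proof -
    have "U_class \<Omega> D y (a * b) = U_class \<Omega> D y 1"
      using that relators_subset_rel_ideal by (auto simp: U_class_eq_iff)
    then show ?thesis using assms by (simp add: rep_1)
  qed
  show "rep (letter (GK i)) (rep (letter (GK_inv i)) m) = m"
    "rep (letter (GK_inv i)) (rep (letter (GK i)) m) = m"
    "rep (letter (GK' i)) (rep (letter (GK'_inv i)) m) = m"
    "rep (letter (GK'_inv i)) (rep (letter (GK' i)) m) = m"
    by (rule 1[OF relators_inverse(1), unfolded rep_mult[OF assms]]
        1[OF relators_inverse(2), unfolded rep_mult[OF assms]]
        1[OF relators_inverse(3), unfolded rep_mult[OF assms]]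
        1[OF relators_inverse(4), unfolded rep_mult[OF assms]])+
qed

end


lemma carrier_U_algE:
  assumes "u \<in> carrier (U_alg \<Omega> D y)" obtains x where "u = U_class \<Omega> D y x"
  using assms by (auto simp: carrier_U_alg)

section \<open>The twisted representation\<close>

text \<open>The universal property of the algebra given by generators and relations: the elements of the free
  algebra that act by zero form an ideal, which contains all relators and therefore the relation ideal.\<close>

lemma U_module_from_rep:
  fixes \<Omega> :: "'i::finite \<Rightarrow> 'i \<Rightarrow> int" and M :: "('i, 'm) wmod" and \<rho> :: "'i free_alg \<Rightarrow> 'm \<Rightarrow> 'm"
  assumes M: "Module.module ground_ring M"
    and closed: "\<And>x. \<rho> x \<in> carrier M \<rightarrow>\<^sub>E carrier M"
    and vector_add: "\<And>x m n. m \<in> carrier M \<Longrightarrow> n \<in> carrier M \<Longrightarrow> \<rho> x (m \<oplus>\<^bsub>M\<^esub> n) = \<rho> x m \<oplus>\<^bsub>M\<^esub> \<rho> x n"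
    and add: "\<And>x w m. m \<in> carrier M \<Longrightarrow> \<rho> (x + w) m = \<rho> x m \<oplus>\<^bsub>M\<^esub> \<rho> w m"
    and mult: "\<And>x w m. m \<in> carrier M \<Longrightarrow> \<rho> (x * w) m = \<rho> x (\<rho> w m)"
    and scal: "\<And>c m. m \<in> carrier M \<Longrightarrow> \<rho> (scal c) m = c \<odot>\<^bsub>M\<^esub> m"
    and relator: "\<And>r m. r \<in> relators \<Omega> D z \<Longrightarrow> m \<in> carrier M \<Longrightarrow> \<rho> r m = \<zero>\<^bsub>M\<^esub>"
  obtains a where "U_module \<Omega> D z (M\<lparr>act := a\<rparr>)"
    and "\<And>x m. m \<in> carrier M \<Longrightarrow> a (U_class \<Omega> D z x) m = \<rho> x m"
proof -
  interpret M: Module.module ground_ring M by (rule M)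
  have \<rho>_closed [simp, intro]: "\<rho> x m \<in> carrier M" if "m \<in> carrier M" for x m
    using closed that by (auto simp: PiE_iff)
  have \<rho>_zero: "\<rho> 0 m = \<zero>\<^bsub>M\<^esub>" if "m \<in> carrier M" for m
    using scal[OF that, of 0] M.smult_l_null[OF that] by simp
  have \<rho>_vector_zero: "\<rho> x \<zero>\<^bsub>M\<^esub> = \<zero>\<^bsub>M\<^esub>" for x
    using vector_add[of "\<zero>\<^bsub>M\<^esub>" "\<zero>\<^bsub>M\<^esub>" x] by simp
  define J where "J = {x. \<forall>m\<in>carrier M. \<rho> x m = \<zero>\<^bsub>M\<^esub>}"
  have "ideal J free_ring"
  proof (rule idealI)
    show "ring (free_ring :: 'i free_alg ring)" by (rule ring_free_ring)
    show "subgroup J (add_monoid free_ring)"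
    proof (rule free_ring.add.subgroupI)
      show "\<ominus>\<^bsub>free_ring\<^esub> x \<in> J" if "x \<in> J" for x
      proof -
        have "\<ominus>\<^bsub>free_ring\<^esub> x = scal (- 1) * x"
          by (rule free_ring.minus_equality) (simp_all add: scal_uminus)
        then show ?thesis
          using that by (simp add: J_def mult \<rho>_vector_zero)
      qed
    qed (auto simp: J_def add intro!: exI[of _ 0] \<rho>_zero)
  qed (auto simp: J_def mult \<rho>_vector_zero)
  then have rel: "rel_ideal \<Omega> D z \<subseteq> J"
    unfolding rel_ideal_def using relator by (intro free_ring.genideal_minimal) (auto simp: J_def)
  define a where "a = restrict (\<lambda>u. \<rho> (SOME x. U_class \<Omega> D z x = u)) (carrier (U_alg \<Omega> D z))"
  have a_class: "a (U_class \<Omega> D z x) = \<rho> x" for x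
  proof -
    define x' where "x' = (SOME x'. U_class \<Omega> D z x' = U_class \<Omega> D z x)"
    have "U_class \<Omega> D z x' = U_class \<Omega> D z x"
      unfolding x'_def by (rule someI) (rule refl)
    then have "x' - x \<in> J"
      using rel by (auto simp: U_class_eq_iff)
    then have "\<rho> x' m = \<rho> x m" if "m \<in> carrier M" for m
      using add[OF that, of "x' - x" x] that by (simp add: J_def)
    then have "\<rho> x' = \<rho> x"
      using closed[of x] closed[of x'] by (intro PiE_ext)
    then show ?thesis by (simp add: a_def x'_def)
  qed
  have one: "1 \<odot>\<^bsub>M\<^esub> m = m" if "m \<in> carrier M" for m
    using M.smult_one[OF that] by simp
  have "U_module \<Omega> D z (M\<lparr>act := a\<rparr>)"
  proof (rule U_module.intro)
    show "act (M\<lparr>act := a\<rparr>) \<in> carrier (U_alg \<Omega> D z) \<rightarrow>\<^sub>E (carrier (M\<lparr>act := a\<rparr>) \<rightarrow>\<^sub>E carrier (M\<lparr>act := a\<rparr>))"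
    proof (rule PiE_I)
      fix u assume "u \<in> carrier (U_alg \<Omega> D z)"
      then show "act (M\<lparr>act := a\<rparr>) u \<in> carrier (M\<lparr>act := a\<rparr>) \<rightarrow>\<^sub>E carrier (M\<lparr>act := a\<rparr>)"
        using closed by (elim carrier_U_algE) (simp add: a_class)
    qed (simp add: a_def)
  qed (auto simp: carrier_U_alg a_class vector_add add mult scal one M simp flip: U_class_add U_class_mult U_class_one scal_1)
  then show thesis
    using a_class by (intro that) auto
qed

sublocale weight_module \<subseteq> graded_space M L
  by unfold_locales (rule decomposition)

locale cartan_module = cartan_lattice \<Omega> L D + weight_module \<Omega> D y M L
  for \<Omega> :: "'i::finite \<Rightarrow> 'i \<Rightarrow> int" and L :: "(rat ^ 'i) set" and D :: nat
    and y :: ratfun and M :: "('i, 'm) wmod" +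
  assumes param_nonzero [simp]: "y \<noteq> 0"
begin

text \<open>The eigenvalues of the Cartan generators and their inverses. The value \<open>1\<close> for the \<open>E\<close> and \<open>F\<close> is
  a dummy.\<close>

definition cartan_value :: "rat ^ 'i \<Rightarrow> 'i gen \<Rightarrow> ratfun" where
  "cartan_value \<mu> g = (case g of
     GK i \<Rightarrow> v_pow D (sform \<Omega> (simple_root i) \<mu>) * fpow D y (cartan_exponent \<Omega> \<mu> i)
   | GK' i \<Rightarrow> v_pow D (- sform \<Omega> (simple_root i) \<mu>) * fpow D y (cartan_exponent \<Omega> \<mu> i)
   | GK_inv i \<Rightarrow> inverse (v_pow D (sform \<Omega> (simple_root i) \<mu>) * fpow D y (cartan_exponent \<Omega> \<mu> i))
   | GK'_inv i \<Rightarrow> inverse (v_pow D (- sform \<Omega> (simple_root i) \<mu>) * fpow D y (cartan_exponent \<Omega> \<mu> i))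
   | _ \<Rightarrow> 1)"

lemma rep_cartan:
  assumes "\<mu> \<in> L" "m \<in> wt M \<mu>" "g \<notin> range GE" "g \<notin> range GF"
  shows "rep (letter g) m = cartan_value \<mu> g \<odot>\<^bsub>M\<^esub> m"
proof -
  have [simp]: "m \<in> carrier M" using assms by auto
  note K = K_weight[OF assms(1,2), unfolded U_gen_def, folded cartan_exponent_def]
    K'_weight[OF assms(1,2), unfolded U_gen_def, folded cartan_exponent_def]
  have inv: "rep x' m = inverse c \<odot>\<^bsub>M\<^esub> m"
    if "rep x' (rep x m) = m" "rep x m = c \<odot>\<^bsub>M\<^esub> m" "c \<noteq> 0" for x x' c
  proof -
    have "inverse c \<odot>\<^bsub>M\<^esub> m = inverse c \<odot>\<^bsub>M\<^esub> rep x' (rep x m)"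
      using that(1) by simp
    also have "\<dots> = (inverse c * c) \<odot>\<^bsub>M\<^esub> rep x' m"
      using smult_assoc1[of "inverse c" c "rep x' m"] by (simp add: that(2) rep_smult)
    also have "\<dots> = rep x' m"
      using that(3) smult_one[of "rep x' m"] by simp
    finally show ?thesis ..
  qed
  show ?thesis
    using assms(3,4) K inv[OF rep_GK_inverse(2) K(1)] inv[OF rep_GK_inverse(4) K(2)]
    by (cases g) (simp_all add: cartan_value_def)
qed

lemma rep_letter_weight:
  assumes "\<mu> \<in> L" "m \<in> wt M \<mu>"
  shows "rep (letter g) m \<in> wt M (\<mu> + gen_wt g)"
proof (cases "g \<in> range GE \<union> range GF")
  case True
  then show ?thesis
    using E_weight[OF assms] F_weight[OF assms] by (auto simp: U_gen_def)
next
  case False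
  then have "gen_wt g = 0" by (cases g) auto
  with False show ?thesis
    using assms rep_cartan[OF assms, of g] by (simp add: wt_smult)
qed

lemma rep_single_weight:
  assumes "\<mu> \<in> L" "m \<in> wt M \<mu>"
  shows "rep (Poly_Mapping.single w c) m \<in> wt M (\<mu> + word_wt (letters w))"
proof -
  have [simp]: "m \<in> carrier M" using assms by auto
  have "rep (Poly_Mapping.single (Word gs) c) m \<in> wt M (\<mu> + word_wt gs)" for gs
  proof (induction gs)
    case Nil
    show ?case using assms by (simp add: single_Nil rep_scal wt_smult word_wt_def)
  next
    case (Cons g gs)
    then show ?case
      using rep_letter_weight[OF _ Cons, of g] assms(1)
      by (simp add: single_Cons rep_mult word_wt_def add_ac flip: word_wt_def)
         (simp add: word_wt_def add_ac)
  qed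
  then show ?thesis by (cases w) simp
qed

end

locale twist_module = twist \<Omega> L D y s + weight_module \<Omega> D y M L
  for \<Omega> :: "'i::finite \<Rightarrow> 'i \<Rightarrow> int" and L :: "(rat ^ 'i) set" and D :: nat
    and y s :: ratfun and M :: "('i, 'm) wmod"
begin

sublocale cartan_module \<Omega> L D y M
  by unfold_locales simp

definition is_twisted_rep :: "'i free_alg \<Rightarrow> ('m \<Rightarrow> 'm) \<Rightarrow> bool" where
  "is_twisted_rep x G \<longleftrightarrow> G \<in> carrier M \<rightarrow>\<^sub>E carrier M
     \<and> (\<forall>m\<in>carrier M. \<forall>n\<in>carrier M. G (m \<oplus>\<^bsub>M\<^esub> n) = G m \<oplus>\<^bsub>M\<^esub> G n)
     \<and> (\<forall>\<mu>\<in>L. \<forall>m\<in>wt M \<mu>. G m = rep (\<Theta> \<mu> x) m)"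

text \<open>The action of an element of the free algebra glued from the weight spaces; it exists and is unique by
  the direct sum property, and the choice operator just names it.\<close>

definition twisted_rep :: "'i free_alg \<Rightarrow> 'm \<Rightarrow> 'm" where
  "twisted_rep x = (SOME G. is_twisted_rep x G)"

lemma is_twisted_rep_twisted_rep: "is_twisted_rep x (twisted_rep x)"
proof -
  have closed: "rep (\<Theta> \<mu> x) m \<in> carrier M" if "\<mu> \<in> L" "m \<in> wt M \<mu>" for \<mu> m
    using wt_subset[OF that] by simp
  have add: "rep (\<Theta> \<mu> x) (m \<oplus>\<^bsub>M\<^esub> n) = rep (\<Theta> \<mu> x) m \<oplus>\<^bsub>M\<^esub> rep (\<Theta> \<mu> x) n"
    if "\<mu> \<in> L" "m \<in> wt M \<mu>" "n \<in> wt M \<mu>" for \<mu> m n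
    using that by (intro rep_vector_add wt_subset)
  show ?thesis
  proof (rule additive_extension[of "\<lambda>\<mu>. rep (\<Theta> \<mu> x)", OF closed add])
    fix G
    assume "G \<in> carrier M \<rightarrow>\<^sub>E carrier M"
      "\<And>m n. m \<in> carrier M \<Longrightarrow> n \<in> carrier M \<Longrightarrow> G (m \<oplus>\<^bsub>M\<^esub> n) = G m \<oplus>\<^bsub>M\<^esub> G n"
      "\<And>\<mu> m. \<mu> \<in> L \<Longrightarrow> m \<in> wt M \<mu> \<Longrightarrow> G m = rep (\<Theta> \<mu> x) m"
    then have "is_twisted_rep x G"
      by (simp add: is_twisted_rep_def)
    then show ?thesis
      unfolding twisted_rep_def by (rule someI[of "is_twisted_rep x"])
  qed
qed

lemma twisted_rep_PiE: "twisted_rep x \<in> carrier M \<rightarrow>\<^sub>E carrier M"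
  using is_twisted_rep_twisted_rep by (simp add: is_twisted_rep_def)

lemma twisted_rep_closed [simp]: "m \<in> carrier M \<Longrightarrow> twisted_rep x m \<in> carrier M"
  using twisted_rep_PiE by (auto simp: PiE_iff)

lemma twisted_rep_vector_add:
  "m \<in> carrier M \<Longrightarrow> n \<in> carrier M \<Longrightarrow>
    twisted_rep x (m \<oplus>\<^bsub>M\<^esub> n) = twisted_rep x m \<oplus>\<^bsub>M\<^esub> twisted_rep x n"
  using is_twisted_rep_twisted_rep by (simp add: is_twisted_rep_def)

lemma twisted_rep_weight:
  "\<mu> \<in> L \<Longrightarrow> m \<in> wt M \<mu> \<Longrightarrow> twisted_rep x m = rep (\<Theta> \<mu> x) m"
  using is_twisted_rep_twisted_rep by (simp add: is_twisted_rep_def)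

lemma twisted_rep_vector_zero: "twisted_rep x \<zero>\<^bsub>M\<^esub> = \<zero>\<^bsub>M\<^esub>"
  using twisted_rep_vector_add[of "\<zero>\<^bsub>M\<^esub>" "\<zero>\<^bsub>M\<^esub>" x] by simp

lemma twisted_rep_add:
  assumes "m \<in> carrier M"
  shows "twisted_rep (a + b) m = twisted_rep a m \<oplus>\<^bsub>M\<^esub> twisted_rep b m"
  using assms
proof (induction m rule: weight_induct)
  case (weight \<mu> m)
  note [simp] = wt_subset[OF weight]
  then show ?case by (simp add: twisted_rep_weight[OF weight] twist_free_add rep_add)
next
  case (add m n)
  then show ?case by (simp add: twisted_rep_vector_add a_ac)
qed (simp add: twisted_rep_vector_zero)

lemma twisted_rep_scal: "m \<in> carrier M \<Longrightarrow> twisted_rep (scal c) m = c \<odot>\<^bsub>M\<^esub> m"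
proof (induction m rule: weight_induct)
  case (weight \<mu> m)
  note [simp] = wt_subset[OF weight]
  then show ?case by (simp add: twisted_rep_weight[OF weight] rep_scal)
next
  case (add m n)
  then show ?case by (simp add: twisted_rep_vector_add smult_r_distr)
qed (simp add: twisted_rep_vector_zero smult_r_null)

text \<open>Induction on the right factor reduces the claim to a single word, which maps weight vectors to weight
  vectors; then the cocycle law of the twist applies.\<close>

lemma twisted_rep_mult:
  "m \<in> carrier M \<Longrightarrow> twisted_rep (a * b) m = twisted_rep a (twisted_rep b m)"
proof (induction b arbitrary: m rule: free_alg_additive_induct)
  case (single w c)
  from single show ?case
  proof (induction m rule: weight_induct)
    case (weight \<mu> m)
    note [simp] = wt_subset[OF weight]
    have "rep (\<Theta> \<mu> (Poly_Mapping.single w c)) m \<in> wt M (\<mu> + word_wt (letters w))"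
      unfolding twist_free_single by (rule rep_single_weight[OF weight])
    then show ?case
      using weight by (simp add: twisted_rep_weight[OF weight] twist_free_mult_single rep_mult
          twisted_rep_weight[of "\<mu> + word_wt (letters w)"])
  next
    case (add m n)
    then show ?case by (simp add: twisted_rep_vector_add)
  qed (simp add: twisted_rep_vector_zero)
next
  case (add x z)
  then show ?case by (simp add: ring_distribs twisted_rep_add twisted_rep_vector_add)
qed

lemma twisted_rep_relator:
  assumes "r \<in> relators \<Omega> D (y * s)" "m \<in> carrier M"
  shows "twisted_rep r m = \<zero>\<^bsub>M\<^esub>"
  using assms(2)
proof (induction m rule: weight_induct)
  case (weight \<mu> m)
  note [simp] = wt_subset[OF weight]
  from twist_free_relator[OF weight(1) assms(1)]
  obtain C r' where r': "r' \<in> relators \<Omega> D y" "\<Theta> \<mu> r = scal C * r'"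
    by (elim exE bexE)
  have "twisted_rep r m = C \<odot>\<^bsub>M\<^esub> rep r' m"
    by (simp add: twisted_rep_weight[OF weight] r'(2) rep_scal_mult)
  also have "\<dots> = \<zero>\<^bsub>M\<^esub>"
    by (simp add: rep_relator[OF r'(1)] smult_r_null)
  finally show ?case .
next
  case (add m n)
  then show ?case by (simp add: twisted_rep_vector_add)
qed (simp add: twisted_rep_vector_zero)

text \<open>The twisting formulas for the \<open>E\<close> and \<open>F\<close>. Those for the Cartan generators are part of the notion of a
  weight module for the parameter \<open>y * s\<close>.\<close>

definition twisted_action :: "('i free_alg set \<Rightarrow> 'm \<Rightarrow> 'm) \<Rightarrow> bool" where
  "twisted_action a \<longleftrightarrow> (\<forall>i. \<forall>\<mu>\<in>L. \<forall>m\<in>wt M \<mu>.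
     a (U_gen \<Omega> D (y * s) (GE i)) m = gs \<mu> (GE i) \<odot>\<^bsub>M\<^esub> act M (U_gen \<Omega> D y (GE i)) m \<and>
     a (U_gen \<Omega> D (y * s) (GF i)) m = gs \<mu> (GF i) \<odot>\<^bsub>M\<^esub> act M (U_gen \<Omega> D y (GF i)) m)"

theorem twisted_action_exists:
  obtains a where "weight_module \<Omega> D (y * s) (M\<lparr>act := a\<rparr>) L" and "twisted_action a"
proof -
  obtain a where U: "U_module \<Omega> D (y * s) (M\<lparr>act := a\<rparr>)"
    and a: "\<And>x m. m \<in> carrier M \<Longrightarrow> a (U_class \<Omega> D (y * s) x) m = twisted_rep x m"
    by (rule U_module_from_rep[of M twisted_rep \<Omega> D "y * s"])
      (simp_all add: vector_space twisted_rep_PiE twisted_rep_vector_add twisted_rep_add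
        twisted_rep_mult twisted_rep_scal twisted_rep_relator)
  have gen: "a (U_gen \<Omega> D (y * s) g) m = gs \<mu> g \<odot>\<^bsub>M\<^esub> act M (U_gen \<Omega> D y g) m"
    if "\<mu> \<in> L" "m \<in> wt M \<mu>" for \<mu> m g
    using that wt_subset[OF that] by (simp add: U_gen_def a twisted_rep_weight[OF that] twist_free_letter rep_scal_mult)
  have "weight_module \<Omega> D (y * s) (M\<lparr>act := a\<rparr>) L"
  proof (rule weight_module.intro[OF U], unfold_locales)
    fix \<mu> m i assume \<mu>: "\<mu> \<in> L" and "m \<in> wt (M\<lparr>act := a\<rparr>) \<mu>"
    then have m: "m \<in> wt M \<mu>" by simp
    note gen = gen[OF \<mu> m]
    have assoc: "c \<odot>\<^bsub>M\<^esub> (d \<odot>\<^bsub>M\<^esub> m) = (c * d) \<odot>\<^bsub>M\<^esub> m" for c d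
      using smult_assoc1[of c d m] wt_subset[OF \<mu> m] by simp
    show "act (M\<lparr>act := a\<rparr>) (U_gen \<Omega> D (y * s) (GE i)) m \<in> wt (M\<lparr>act := a\<rparr>) (\<mu> + simple_root i)"
      "act (M\<lparr>act := a\<rparr>) (U_gen \<Omega> D (y * s) (GF i)) m \<in> wt (M\<lparr>act := a\<rparr>) (\<mu> - simple_root i)"
      using E_weight[OF \<mu> m] F_weight[OF \<mu> m] \<mu> by (simp_all add: gen wt_smult)
    show "act (M\<lparr>act := a\<rparr>) (U_gen \<Omega> D (y * s) (GK i)) m =
        (v_pow D (sform \<Omega> (simple_root i) \<mu>)
          * fpow D (y * s) (eform \<Omega> \<mu> (simple_root i) - eform \<Omega> (simple_root i) \<mu>)) \<odot>\<^bsub>M\<lparr>act := a\<rparr>\<^esub> m"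
      "act (M\<lparr>act := a\<rparr>) (U_gen \<Omega> D (y * s) (GK' i)) m =
        (v_pow D (- sform \<Omega> (simple_root i) \<mu>)
          * fpow D (y * s) (eform \<Omega> \<mu> (simple_root i) - eform \<Omega> (simple_root i) \<mu>)) \<odot>\<^bsub>M\<lparr>act := a\<rparr>\<^esub> m"
      by (simp_all add: gen K_weight[OF \<mu> m] K'_weight[OF \<mu> m] assoc gen_scalar_def cartan_exponent_def
          fpow_base_mult) (simp_all add: mult_ac)
  qed (simp_all add: finite_dimensional decomposition)
  moreover have "twisted_action a"
    by (simp add: twisted_action_def gen)
  ultimately show thesis by (rule that)
qed

end


section \<open>Submodules are graded\<close>

lemma sform_expand_left: "sform \<Omega> x z = (\<Sum>i\<in>UNIV. x $ i * sform \<Omega> (simple_root i) z)"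
proof -
  have root: "sform \<Omega> (simple_root i) z = (\<Sum>j\<in>UNIV. z $ j * of_int (\<Omega> i j + \<Omega> j i))" for i
    unfolding sform_def simple_root_def axis_def
    by (subst sum.remove[of _ i]) (auto intro!: sum.neutral)
  show ?thesis
    unfolding root sum_distrib_left unfolding sform_def by (simp add: mult.assoc)
qed

lemma sform_diff_right: "sform \<Omega> x (a - b) = sform \<Omega> x a - sform \<Omega> x b"
  unfolding sform_def sum_subtractf[symmetric] by (simp add: left_diff_distrib right_diff_distrib)

text \<open>A positive definite form is nondegenerate, and the simple roots span the rational space.\<close>

lemma (in finite_cartan_datum) sform_separates:
  assumes "\<And>i. sform \<Omega> (simple_root i) a = sform \<Omega> (simple_root i) b"
  shows "a = b"
proof (rule ccontr)
  assume "a \<noteq> b"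
  then have "sform \<Omega> (a - b) (a - b) > 0" by (intro finite_type) simp
  moreover have "sform \<Omega> (a - b) (a - b) = 0"
    by (subst sform_expand_left) (simp add: sform_diff_right assms)
  ultimately show False by simp
qed

lemma (in U_module) rep_finsum:
  assumes "finite A" "\<And>a. a \<in> A \<Longrightarrow> f a \<in> carrier M"
  shows "rep x (\<Oplus>\<^bsub>M\<^esub>a\<in>A. f a) = (\<Oplus>\<^bsub>M\<^esub>a\<in>A. rep x (f a))"
  using assms
proof (induction A rule: finite_induct)
  case empty
  show ?case by (simp add: rep_vector_zero)
next
  case (insert b A)
  then have "f \<in> A \<rightarrow> carrier M" "f b \<in> carrier M" by auto
  with insert show ?case by (simp add: rep_vector_add Pi_iff)
qed

lemma (in U_module) U_submodule_rep: "U_submodule \<Omega> D y M N \<Longrightarrow> m \<in> N \<Longrightarrow> rep x m \<in> N"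
  by (simp add: U_submodule_def)

lemma (in Module.module) submodule_finsum:
  assumes "submodule N R M" "finite A" "\<And>a. a \<in> A \<Longrightarrow> f a \<in> N"
  shows "(\<Oplus>\<^bsub>M\<^esub>a\<in>A. f a) \<in> N"
  using assms(2,3)
proof (induction A rule: finite_induct)
  case empty
  show ?case using assms(1)[THEN submodule.axioms(1), THEN subgroup.one_closed] by simp
next
  case (insert b A)
  then have "f \<in> A \<rightarrow> carrier M" "f b \<in> carrier M" using submoduleE(1)[OF assms(1)] by auto
  with insert show ?case by (simp add: submoduleE(5)[OF assms(1)])
qed

context cartan_module
begin

text \<open>The eigenvalue of \<open>K\<^sub>i\<close> times the inverse of \<open>K'\<^sub>i\<close>, in which the powers of the parameter \<open>y\<close> cancel.\<close>

definition separator :: "'i \<Rightarrow> rat ^ 'i \<Rightarrow> ratfun" where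
  "separator i \<mu> = v_pow D (sform \<Omega> (simple_root i) \<mu> + sform \<Omega> (simple_root i) \<mu>)"

lemma rep_separator:
  assumes "\<mu> \<in> L" "m \<in> wt M \<mu>"
  shows "rep (letter (GK i) * letter (GK'_inv i)) m = separator i \<mu> \<odot>\<^bsub>M\<^esub> m"
proof -
  note m = wt_subset[OF assms]
  have "cartan_value \<mu> (GK i) * cartan_value \<mu> (GK'_inv i) = separator i \<mu>"
    using assms(1) unfolding separator_def v_pow_def
    by (subst fpow_add) (simp_all add: cartan_value_def v_pow_def fpow_uminus)
  moreover have "rep (letter (GK i) * letter (GK'_inv i)) m =
      (cartan_value \<mu> (GK'_inv i) * cartan_value \<mu> (GK i)) \<odot>\<^bsub>M\<^esub> m"
    using smult_assoc1[of "cartan_value \<mu> (GK'_inv i)" "cartan_value \<mu> (GK i)" m] m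
      rep_cartan[OF assms, of "GK i"] rep_cartan[OF assms, of "GK'_inv i"]
    by (simp add: rep_mult rep_smult image_iff)
  ultimately show ?thesis by (simp add: mult.commute)
qed

lemma separator_separates:
  assumes "\<mu> \<in> L" "\<nu> \<in> L" "\<mu> \<noteq> \<nu>"
  obtains i where "separator i \<mu> \<noteq> separator i \<nu>"
proof (rule ccontr)
  assume "\<not> thesis"
  then have eq: "separator i \<mu> = separator i \<nu>" for i using that by blast
  have "sform \<Omega> (simple_root i) \<mu> = sform \<Omega> (simple_root i) \<nu>" for i
  proof -
    have double: "sform \<Omega> (simple_root i) \<kappa> + sform \<Omega> (simple_root i) \<kappa> \<in> exponents D"
      if "\<kappa> \<in> L" for \<kappa>
      using that by (intro exponents_add sform_exponent simple_root_in_L)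
    have "sform \<Omega> (simple_root i) \<mu> + sform \<Omega> (simple_root i) \<mu> =
        sform \<Omega> (simple_root i) \<nu> + sform \<Omega> (simple_root i) \<nu>"
      using eq[of i] v_pow_eq_iff[OF D_pos double[OF assms(1)] double[OF assms(2)]]
      by (simp only: separator_def)
    then show ?thesis by simp
  qed
  then have "\<mu> = \<nu>" by (rule sform_separates)
  with assms(3) show False ..
qed

text \<open>The usual elimination argument: if \<open>c\<close> is the eigenvalue of a separating operator on the weight space of
  \<open>\<nu>\<close>, subtracting \<open>c\<close> from this operator removes the component at \<open>\<nu>\<close> and rescales the others, so that
  the induction hypothesis applies. The operator is chosen anew for every remaining weight \<open>\<kappa>\<close>, since a
  single simple root need not separate all weights at once.\<close>

lemma submodule_component:
  assumes N: "U_submodule \<Omega> D y M N" and "finite S" "S \<subseteq> L"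
    and "\<And>\<mu>. \<mu> \<in> S \<Longrightarrow> f \<mu> \<in> wt M \<mu>" and "(\<Oplus>\<^bsub>M\<^esub>\<mu>\<in>S. f \<mu>) \<in> N" and "\<mu> \<in> S"
  shows "f \<mu> \<in> N"
  using assms(2-)
proof (induction S arbitrary: f \<mu> rule: finite_induct)
  case (insert \<nu> S)
  have sub: "submodule N ground_ring M" using N by (simp add: U_submodule_def)
  have \<nu>: "\<nu> \<in> L" and S: "S \<subseteq> L" using insert.prems(1) by auto
  have f: "f \<kappa> \<in> carrier M" if "\<kappa> \<in> insert \<nu> S" for \<kappa>
    using that insert.prems(1) insert.prems(2)[OF that] by (intro wt_subset[of \<kappa>]) auto
  then have fS: "f \<in> S \<rightarrow> carrier M" and f\<nu>: "f \<nu> \<in> carrier M" by simp_all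
  have fN: "f \<kappa> \<in> N" if \<kappa>: "\<kappa> \<in> S" for \<kappa>
  proof -
    have "\<kappa> \<in> L" "\<kappa> \<noteq> \<nu>" using \<kappa> S insert.hyps by auto
    then obtain i where i: "separator i \<kappa> \<noteq> separator i \<nu>"
      using separator_separates \<nu> by metis
    define x where "x = letter (GK i) * letter (GK'_inv i) + scal (- separator i \<nu>)"
    have x: "rep x (f \<xi>) = (separator i \<xi> - separator i \<nu>) \<odot>\<^bsub>M\<^esub> f \<xi>" if "\<xi> \<in> insert \<nu> S" for \<xi>
    proof -
      have "\<xi> \<in> L" using that insert.prems(1) by auto
      then show ?thesis
        using smult_l_distr[of "separator i \<xi>" "- separator i \<nu>" "f \<xi>"] f[OF that]
        by (simp add: x_def rep_add rep_scal rep_separator[OF _ insert.prems(2)[OF that]])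
    qed
    have "rep x (\<Oplus>\<^bsub>M\<^esub>\<mu>\<in>insert \<nu> S. f \<mu>) = (\<Oplus>\<^bsub>M\<^esub>\<mu>\<in>insert \<nu> S. rep x (f \<mu>))"
      using insert.hyps f by (intro rep_finsum) auto
    also have "\<dots> = rep x (f \<nu>) \<oplus>\<^bsub>M\<^esub> (\<Oplus>\<^bsub>M\<^esub>\<mu>\<in>S. rep x (f \<mu>))"
      using insert.hyps fS f\<nu> by (intro finsum_insert) auto
    also have "\<dots> = (\<Oplus>\<^bsub>M\<^esub>\<mu>\<in>S. rep x (f \<mu>))"
    proof -
      have "(\<Oplus>\<^bsub>M\<^esub>\<mu>\<in>S. rep x (f \<mu>)) \<in> carrier M"
        using fS by (intro finsum_closed) auto
      then show ?thesis
        using smult_l_null[OF f\<nu>] by (simp add: x[of \<nu>])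
    qed
    finally have "(\<Oplus>\<^bsub>M\<^esub>\<mu>\<in>S. rep x (f \<mu>)) \<in> N"
      using U_submodule_rep[OF N insert.prems(3), of x] by simp
    moreover have "rep x (f \<xi>) \<in> wt M \<xi>" if "\<xi> \<in> S" for \<xi>
      using that S insert.prems(2)[of \<xi>] x[of \<xi>] by (simp add: subset_iff wt_smult)
    ultimately have "rep x (f \<kappa>) \<in> N"
      using insert.IH[OF S, of "\<lambda>\<mu>. rep x (f \<mu>)" \<kappa>] \<kappa> by simp
    then have "inverse (separator i \<kappa> - separator i \<nu>) \<odot>\<^bsub>M\<^esub> rep x (f \<kappa>) \<in> N"
      using submoduleE(4)[OF sub] by simp
    also have "inverse (separator i \<kappa> - separator i \<nu>) \<odot>\<^bsub>M\<^esub> rep x (f \<kappa>) = f \<kappa>"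
      using smult_assoc1[of "inverse (separator i \<kappa> - separator i \<nu>)" "separator i \<kappa> - separator i \<nu>" "f \<kappa>"]
        smult_one[of "f \<kappa>"] \<kappa> f[of \<kappa>] i by (simp add: x)
    finally show ?thesis .
  qed
  have sum_N: "(\<Oplus>\<^bsub>M\<^esub>\<mu>\<in>S. f \<mu>) \<in> N"
    using sub insert.hyps(1) fN by (rule submodule_finsum)
  then have sum_carrier: "(\<Oplus>\<^bsub>M\<^esub>\<mu>\<in>S. f \<mu>) \<in> carrier M"
    using submoduleE(1)[OF sub] by blast
  have "f \<nu> \<oplus>\<^bsub>M\<^esub> (\<Oplus>\<^bsub>M\<^esub>\<mu>\<in>S. f \<mu>) \<in> N"
    using insert.prems(3) insert.hyps fS f\<nu> by simp
  then have "(f \<nu> \<oplus>\<^bsub>M\<^esub> (\<Oplus>\<^bsub>M\<^esub>\<mu>\<in>S. f \<mu>)) \<oplus>\<^bsub>M\<^esub> (\<ominus>\<^bsub>M\<^esub> (\<Oplus>\<^bsub>M\<^esub>\<mu>\<in>S. f \<mu>)) \<in> N"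
    using submoduleE(5)[OF sub] submoduleE(3)[OF sub sum_N] by blast
  then have "f \<nu> \<in> N"
    using f\<nu> sum_carrier by (simp add: a_assoc r_neg)
  then show ?case
    using fN insert.prems(4) by auto
qed simp

lemma U_submodule_induct [consumes 2, case_names zero weight add]:
  assumes N: "U_submodule \<Omega> D y M N" and "m \<in> N" and zero: "P \<zero>\<^bsub>M\<^esub>"
    and weight: "\<And>\<mu> m. \<mu> \<in> L \<Longrightarrow> m \<in> wt M \<mu> \<Longrightarrow> m \<in> N \<Longrightarrow> P m"
    and add: "\<And>m n. m \<in> N \<Longrightarrow> n \<in> N \<Longrightarrow> P m \<Longrightarrow> P n \<Longrightarrow> P (m \<oplus>\<^bsub>M\<^esub> n)"
  shows "P m"
proof -
  have sub: "submodule N ground_ring M" using N by (simp add: U_submodule_def)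
  have "m \<in> carrier M" using submoduleE(1)[OF sub] assms(2) by blast
  then obtain f where f: "weight_family m f"
    using ex1_implies_ex[OF weight_family_ex1] by blast
  define S where "S = {\<mu>. f \<mu> \<noteq> \<zero>\<^bsub>M\<^esub>}"
  have S: "finite S" "S \<subseteq> L" "m = (\<Oplus>\<^bsub>M\<^esub>\<mu>\<in>S. f \<mu>)" and wt: "\<And>\<mu>. \<mu> \<in> S \<Longrightarrow> f \<mu> \<in> wt M \<mu>"
    using f by (auto simp: weight_family_def S_def)
  have fN: "f \<mu> \<in> N" if "\<mu> \<in> S" for \<mu>
    using submodule_component[OF N S(1,2) wt _ that] assms(2) S(3) by simp
  have "P (\<Oplus>\<^bsub>M\<^esub>\<mu>\<in>A. f \<mu>)" if "finite A" "A \<subseteq> S" for A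
    using that
  proof (induction A rule: finite_induct)
    case empty
    show ?case by (simp add: zero)
  next
    case (insert \<nu> A)
    have "f \<in> A \<rightarrow> carrier M" "f \<nu> \<in> carrier M"
      using weight_family_closed[OF f] by auto
    moreover have "(\<Oplus>\<^bsub>M\<^esub>\<mu>\<in>A. f \<mu>) \<in> N"
      using insert by (intro submodule_finsum[OF sub] fN) auto
    moreover have "P (f \<nu>)" "f \<nu> \<in> N"
      using insert.prems S(2) wt fN by (auto intro!: weight[of \<nu>])
    ultimately show ?case
      using insert by (simp add: add)
  qed
  then show ?thesis using S by simp
qed

end


section \<open>Comparing twisted modules\<close>

text \<open>Weight modules with the same parameter have the same Cartan eigenvalues, so a graded linear map that
  commutes with the \<open>E\<close> and \<open>F\<close> on weight vectors commutes with the whole algebra. With the identity map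
  this says that the action is determined by the \<open>E\<close> and \<open>F\<close>.\<close>

lemma intertwines_rep:
  fixes M N :: "('i::finite, 'm) wmod"
  assumes M: "cartan_module \<Omega> L D y M" and N: "cartan_module \<Omega> L D y N"
    and closed: "\<And>m. m \<in> carrier M \<Longrightarrow> h m \<in> carrier N"
    and add: "\<And>m n. m \<in> carrier M \<Longrightarrow> n \<in> carrier M \<Longrightarrow> h (m \<oplus>\<^bsub>M\<^esub> n) = h m \<oplus>\<^bsub>N\<^esub> h n"
    and smult: "\<And>c m. m \<in> carrier M \<Longrightarrow> h (c \<odot>\<^bsub>M\<^esub> m) = c \<odot>\<^bsub>N\<^esub> h m"
    and wt: "\<And>\<mu> m. \<mu> \<in> L \<Longrightarrow> m \<in> wt M \<mu> \<Longrightarrow> h m \<in> wt N \<mu>"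
    and E: "\<And>i \<mu> m. \<mu> \<in> L \<Longrightarrow> m \<in> wt M \<mu> \<Longrightarrow>
      h (act M (U_gen \<Omega> D y (GE i)) m) = act N (U_gen \<Omega> D y (GE i)) (h m)"
    and F: "\<And>i \<mu> m. \<mu> \<in> L \<Longrightarrow> m \<in> wt M \<mu> \<Longrightarrow>
      h (act M (U_gen \<Omega> D y (GF i)) m) = act N (U_gen \<Omega> D y (GF i)) (h m)"
    and m: "m \<in> carrier M"
  shows "h (act M (U_class \<Omega> D y x) m) = act N (U_class \<Omega> D y x) (h m)"
proof -
  interpret M: cartan_module \<Omega> L D y M by (rule M)
  interpret N: cartan_module \<Omega> L D y N by (rule N)
  have zero: "h \<zero>\<^bsub>M\<^esub> = \<zero>\<^bsub>N\<^esub>"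
    using smult[of "\<zero>\<^bsub>M\<^esub>" 0] M.smult_l_null[of "\<zero>\<^bsub>M\<^esub>"] N.smult_l_null[OF closed[of "\<zero>\<^bsub>M\<^esub>"]] by simp
  from m show ?thesis
  proof (induction x arbitrary: m rule: free_alg_induct)
    case (scal c)
    then show ?case by (simp add: M.rep_scal N.rep_scal smult closed)
  next
    case (letter g)
    then show ?case
    proof (induction m rule: M.weight_induct)
      case (weight \<mu> m)
      show ?case
      proof (cases "g \<in> range GE \<union> range GF")
        case True
        then show ?thesis
          using E[OF weight] F[OF weight] by (auto simp: U_gen_def)
      next
        case False
        then show ?thesis
          using M.rep_cartan[OF weight, of g] N.rep_cartan[OF weight(1) wt[OF weight], of g]
            smult[OF M.wt_subset[OF weight]] by simp
      qed
    next
      case (add m n)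
      then show ?case by (simp add: M.rep_vector_add N.rep_vector_add assms(4) closed)
    qed (simp add: zero M.rep_vector_zero N.rep_vector_zero)
  next
    case (add x z)
    then show ?case by (simp add: M.rep_add N.rep_add assms(4) closed)
  next
    case (mult x z)
    then show ?case by (simp add: M.rep_mult N.rep_mult closed)
  qed
qed

text \<open>Two modules on the same graded space, with actions that differ by the scalars of the twist. The equation
  \<open>same_space\<close> says that the two records differ in the action field at most. The notion is symmetric:
  exchanging the modules inverts \<open>s\<close>.\<close>

locale twisted_pair = cartan_lattice \<Omega> L D + M: weight_module \<Omega> D y M L + M': weight_module \<Omega> D z M' L
  for \<Omega> :: "'i::finite \<Rightarrow> 'i \<Rightarrow> int" and L :: "(rat ^ 'i) set" and D :: nat
    and y z s :: ratfun and M M' :: "('i, 'm) wmod" +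
  assumes params_nonzero: "y \<noteq> 0" "z \<noteq> 0" "s \<noteq> 0"
    and same_space: "M' = M\<lparr>act := act M'\<rparr>"
    and twisted_E: "\<mu> \<in> L \<Longrightarrow> m \<in> wt M \<mu> \<Longrightarrow> act M' (U_gen \<Omega> D z (GE i)) m =
      gen_scalar \<Omega> D s \<mu> (GE i) \<odot>\<^bsub>M\<^esub> act M (U_gen \<Omega> D y (GE i)) m"
    and twisted_F: "\<mu> \<in> L \<Longrightarrow> m \<in> wt M \<mu> \<Longrightarrow> act M' (U_gen \<Omega> D z (GF i)) m =
      gen_scalar \<Omega> D s \<mu> (GF i) \<odot>\<^bsub>M\<^esub> act M (U_gen \<Omega> D y (GF i)) m"
begin

sublocale M: cartan_module \<Omega> L D y M
  by unfold_locales (rule params_nonzero)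

sublocale M': cartan_module \<Omega> L D z M'
  by unfold_locales (rule params_nonzero)

lemma same_space_simps [simp]:
  "carrier M' = carrier M" "add M' = add M" "zero M' = zero M" "smult M' = smult M" "wt M' = wt M"
  using arg_cong[OF same_space, of carrier] arg_cong[OF same_space, of add]
    arg_cong[OF same_space, of zero] arg_cong[OF same_space, of smult]
    arg_cong[OF same_space, of wt] by simp_all

lemma submodule_same_space [simp]: "submodule N R M' \<longleftrightarrow> submodule N R M"
  by (subst same_space) simp

lemma fin_dim_same_space: "fin_dim M' \<longleftrightarrow> fin_dim M"
  by (subst same_space) simp

lemma rep'_letter:
  assumes "\<mu> \<in> L" "m \<in> wt M \<mu>" "g \<in> range GE \<union> range GF"
  shows "M'.rep (letter g) m = gen_scalar \<Omega> D s \<mu> g \<odot>\<^bsub>M\<^esub> M.rep (letter g) m"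
  using assms(3) twisted_E[OF assms(1,2)] twisted_F[OF assms(1,2)] by (auto simp: U_gen_def)

lemma symmetric: "twisted_pair \<Omega> L D z y (inverse s) M' M"
proof
  show "M = M'\<lparr>act := act M\<rparr>" by (subst same_space) simp
  have inv: "m = gen_scalar \<Omega> D (inverse s) \<mu> g \<odot>\<^bsub>M'\<^esub> (gen_scalar \<Omega> D s \<mu> g \<odot>\<^bsub>M\<^esub> m)"
    if "\<mu> \<in> L" "m \<in> carrier M" for \<mu> m g
  proof -
    have "gen_scalar \<Omega> D (inverse s) \<mu> g * gen_scalar \<Omega> D s \<mu> g = 1"
      using params_nonzero gen_exponent_exponent[OF that(1), of g]
      by (simp add: gen_scalar_def fpow_base_inverse fpow_uminus)
    then show ?thesis
      using M.smult_assoc1[of "gen_scalar \<Omega> D (inverse s) \<mu> g" "gen_scalar \<Omega> D s \<mu> g" m]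
        M.smult_one that(2) by simp
  qed
  show "act M (U_gen \<Omega> D y (GE i)) m =
      gen_scalar \<Omega> D (inverse s) \<mu> (GE i) \<odot>\<^bsub>M'\<^esub> act M' (U_gen \<Omega> D z (GE i)) m"
    "act M (U_gen \<Omega> D y (GF i)) m =
      gen_scalar \<Omega> D (inverse s) \<mu> (GF i) \<odot>\<^bsub>M'\<^esub> act M' (U_gen \<Omega> D z (GF i)) m"
    if "\<mu> \<in> L" "m \<in> wt M' \<mu>" for \<mu> m i
  proof -
    have m: "m \<in> wt M \<mu>" using that by simp
    then have closed: "act M (U_gen \<Omega> D y g) m \<in> carrier M" for g
      unfolding U_gen_def by (intro M.rep_closed M.wt_subset[OF that(1)])
    show "act M (U_gen \<Omega> D y (GE i)) m =
      gen_scalar \<Omega> D (inverse s) \<mu> (GE i) \<odot>\<^bsub>M'\<^esub> act M' (U_gen \<Omega> D z (GE i)) m"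
    "act M (U_gen \<Omega> D y (GF i)) m =
      gen_scalar \<Omega> D (inverse s) \<mu> (GF i) \<odot>\<^bsub>M'\<^esub> act M' (U_gen \<Omega> D z (GF i)) m"
      unfolding twisted_E[OF that(1) m] twisted_F[OF that(1) m] by (rule inv[OF that(1) closed])+
  qed
qed (use params_nonzero in auto)

text \<open>On weight vectors of \<open>N\<close> every generator acts in \<open>M'\<close> by a multiple of its action in \<open>M\<close>, and these
  vectors span \<open>N\<close> because submodules are graded.\<close>

lemma U_submodule_twisted:
  assumes N: "U_submodule \<Omega> D y M N"
  shows "U_submodule \<Omega> D z M' N"
proof -
  have sub: "submodule N ground_ring M" using N by (simp add: U_submodule_def)
  have N_carrier: "n \<in> carrier M" if "n \<in> N" for n
    using M.submoduleE(1)[OF sub] that by blast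
  have N_smult: "c \<odot>\<^bsub>M\<^esub> n \<in> N" if "n \<in> N" for c n
    using M.submoduleE(4)[OF sub _ that] by simp
  have N_add: "n \<oplus>\<^bsub>M\<^esub> n' \<in> N" if "n \<in> N" "n' \<in> N" for n n'
    using M.submoduleE(5)[OF sub that] .
  have "M'.rep x m \<in> N" if "m \<in> N" for x m
    using that
  proof (induction x arbitrary: m rule: free_alg_induct)
    case (scal c)
    then show ?case using M'.rep_scal[of m c] by (simp add: N_carrier N_smult)
  next
    case (letter g)
    with N show ?case
    proof (induction m rule: M.U_submodule_induct)
      case zero
      show ?case
        using M'.rep_vector_zero sub[THEN submodule.axioms(1), THEN subgroup.one_closed] by simp
    next
      case (weight \<mu> m)
      show ?case
      proof (cases "g \<in> range GE \<union> range GF")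
        case True
        then show ?thesis
          using rep'_letter[OF weight(1,2)] M.U_submodule_rep[OF N weight(3)] N_smult by simp
      next
        case False
        then show ?thesis
          using M'.rep_cartan[OF weight(1), of m g] weight N_smult by simp
      qed
    next
      case (add m n)
      then show ?case
        using M'.rep_vector_add[of m n "letter g"] by (simp add: N_carrier N_add)
    qed
  next
    case (add x z)
    then show ?case using M'.rep_add[of m x z] by (simp add: N_carrier N_add)
  next
    case (mult x z)
    then show ?case using M'.rep_mult[of m x z] by (simp add: N_carrier)
  qed
  then show ?thesis
    using sub by (auto simp: U_submodule_def elim!: carrier_U_algE)
qed

text \<open>On a weight vector, powers of the two operators are proportional. On a sum of vectors the exponents
  that kill the summands are added up.\<close>

lemma nilpotent_twisted:
  assumes g: "g \<in> range GE \<union> range GF"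
    and nil: "\<And>m. m \<in> carrier M \<Longrightarrow> \<exists>n. (M.rep (letter g) ^^ n) m = \<zero>\<^bsub>M\<^esub>"
    and m: "m \<in> carrier M"
  shows "\<exists>n. (M'.rep (letter g) ^^ n) m = \<zero>\<^bsub>M\<^esub>"
  using m
proof (induction m rule: M.weight_induct)
  case zero
  show ?case by (rule exI[of _ 0]) simp
next
  case (weight \<mu> m)
  have "\<exists>c. (M'.rep (letter g) ^^ n) m = c \<odot>\<^bsub>M\<^esub> (M.rep (letter g) ^^ n) m \<and>
      (M.rep (letter g) ^^ n) m \<in> wt M (\<mu> + word_wt (replicate n g))" for n
  proof (induction n)
    case 0
    show ?case
      using weight M.smult_one[OF M.wt_subset[OF weight]]
      by (intro exI[of _ 1]) (simp add: word_wt_def)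
  next
    case (Suc n)
    define w where "w = (M.rep (letter g) ^^ n) m"
    define \<nu> where "\<nu> = \<mu> + word_wt (replicate n g)"
    have \<nu>: "\<nu> \<in> L" using weight(1) by (simp add: \<nu>_def)
    obtain c where c: "(M'.rep (letter g) ^^ n) m = c \<odot>\<^bsub>M\<^esub> w" and w: "w \<in> wt M \<nu>"
      using Suc unfolding w_def \<nu>_def by blast
    have w': "w \<in> carrier M" by (rule M.wt_subset[OF \<nu> w])
    have "(M'.rep (letter g) ^^ Suc n) m = c \<odot>\<^bsub>M\<^esub> (gen_scalar \<Omega> D s \<nu> g \<odot>\<^bsub>M\<^esub> M.rep (letter g) w)"
      using M'.rep_smult[of w "letter g" c] w' by (simp add: c rep'_letter[OF \<nu> w g])
    also have "\<dots> = (c * gen_scalar \<Omega> D s \<nu> g) \<odot>\<^bsub>M\<^esub> M.rep (letter g) w"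
      using M.smult_assoc1[of c "gen_scalar \<Omega> D s \<nu> g" "M.rep (letter g) w"] w' by simp
    finally have "(M'.rep (letter g) ^^ Suc n) m = (c * gen_scalar \<Omega> D s \<nu> g) \<odot>\<^bsub>M\<^esub> (M.rep (letter g) ^^ Suc n) m"
      by (simp add: w_def)
    moreover have "\<nu> + gen_wt g = \<mu> + word_wt (replicate (Suc n) g)"
      by (simp add: \<nu>_def word_wt_def add_ac)
    then have "(M.rep (letter g) ^^ Suc n) m \<in> wt M (\<mu> + word_wt (replicate (Suc n) g))"
      using M.rep_letter_weight[OF \<nu> w, of g] by (simp add: w_def)
    ultimately show ?case by blast
  qed
  moreover obtain n where "(M.rep (letter g) ^^ n) m = \<zero>\<^bsub>M\<^esub>"
    using nil[OF M.wt_subset[OF weight]] by blast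
  ultimately obtain c where "(M'.rep (letter g) ^^ n) m = c \<odot>\<^bsub>M\<^esub> \<zero>\<^bsub>M\<^esub>"
    by metis
  then have "(M'.rep (letter g) ^^ n) m = \<zero>\<^bsub>M\<^esub>"
    using M.smult_r_null[of c] by simp
  then show ?case ..
next
  case (add m n)
  have pow_closed: "(M'.rep (letter g) ^^ k) w \<in> carrier M" if "w \<in> carrier M" for k w
    using that M'.rep_closed[of _ "letter g"] by (induction k) simp_all
  have pow_add: "(M'.rep (letter g) ^^ k) (w \<oplus>\<^bsub>M\<^esub> w') =
      (M'.rep (letter g) ^^ k) w \<oplus>\<^bsub>M\<^esub> (M'.rep (letter g) ^^ k) w'"
    if "w \<in> carrier M" "w' \<in> carrier M" for k w w'
    using that M'.rep_vector_add[of _ _ "letter g"] by (induction k) (simp_all add: pow_closed)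
  have pow_zero: "(M'.rep (letter g) ^^ k) \<zero>\<^bsub>M\<^esub> = \<zero>\<^bsub>M\<^esub>" for k
    using M'.rep_vector_zero[of "letter g"] by (induction k) simp_all
  from add obtain k l where k: "(M'.rep (letter g) ^^ k) m = \<zero>\<^bsub>M\<^esub>" and l: "(M'.rep (letter g) ^^ l) n = \<zero>\<^bsub>M\<^esub>"
    by blast
  have "(M'.rep (letter g) ^^ (l + k)) m = \<zero>\<^bsub>M\<^esub>"
    by (simp add: funpow_add k pow_zero)
  moreover have "(M'.rep (letter g) ^^ (l + k)) n = \<zero>\<^bsub>M\<^esub>"
    by (subst add.commute) (simp add: funpow_add l pow_zero)
  ultimately have "(M'.rep (letter g) ^^ (l + k)) (m \<oplus>\<^bsub>M\<^esub> n) = \<zero>\<^bsub>M\<^esub>"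
    using add by (simp add: pow_add)
  then show ?case ..
qed

lemma integrable_twisted:
  assumes "integrable_mod \<Omega> D y M"
  shows "integrable_mod \<Omega> D z M'"
proof -
  have "\<exists>n. (M'.rep (letter g) ^^ n) m = \<zero>\<^bsub>M\<^esub>"
    if "g \<in> range GE \<union> range GF" "m \<in> carrier M" for g m
    using assms that by (intro nilpotent_twisted) (auto simp: integrable_mod_def U_gen_def)
  then show ?thesis by (simp add: integrable_mod_def U_gen_def)
qed

text \<open>The inclusion of submodules in the direction from \<open>M'\<close> to \<open>M\<close> is an assumption here, as it comes from the
  symmetric instance of the locale.\<close>

lemma simple_twisted:
  assumes "\<And>N. U_submodule \<Omega> D z M' N \<Longrightarrow> U_submodule \<Omega> D y M N" and "simple_mod \<Omega> D y M"
  shows "simple_mod \<Omega> D z M'"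
  using assms by (auto simp: simple_mod_def)

lemma highest_weight_twisted:
  assumes "\<And>N. U_submodule \<Omega> D z M' N \<Longrightarrow> U_submodule \<Omega> D y M N"
    and "\<Lambda> \<in> L" and "highest_weight_mod \<Omega> D y \<Lambda> M"
  shows "highest_weight_mod \<Omega> D z \<Lambda> M'"
proof -
  from assms(3) obtain m where m: "m \<in> wt M \<Lambda>" "m \<noteq> \<zero>\<^bsub>M\<^esub>"
    "\<And>i. act M (U_gen \<Omega> D y (GE i)) m = \<zero>\<^bsub>M\<^esub>"
    "\<And>N. U_submodule \<Omega> D y M N \<Longrightarrow> m \<in> N \<Longrightarrow> N = carrier M"
    by (auto simp: highest_weight_mod_def)
  show ?thesis
    unfolding highest_weight_mod_def
  proof (intro bexI[of _ m] conjI allI impI)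
    show "act M' (U_gen \<Omega> D z (GE i)) m = \<zero>\<^bsub>M'\<^esub>" for i
      using twisted_E[OF assms(2) m(1), of i] M.smult_r_null by (simp add: m(3))
    show "N = carrier M'" if "U_submodule \<Omega> D z M' N \<and> m \<in> N" for N
      using m(4)[of N] assms(1)[of N] that by simp
  qed (use m in simp_all)
qed

lemma twist_invariants:
  shows "fin_dim M' \<longleftrightarrow> fin_dim M"
    and "integrable_mod \<Omega> D z M' \<longleftrightarrow> integrable_mod \<Omega> D y M"
    and "simple_mod \<Omega> D z M' \<longleftrightarrow> simple_mod \<Omega> D y M"
    and "\<Lambda> \<in> L \<Longrightarrow> highest_weight_mod \<Omega> D z \<Lambda> M' \<longleftrightarrow> highest_weight_mod \<Omega> D y \<Lambda> M"
proof -
  interpret inv: twisted_pair \<Omega> L D z y "inverse s" M' M by (rule symmetric)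
  show "fin_dim M' \<longleftrightarrow> fin_dim M" by (rule fin_dim_same_space)
  show "integrable_mod \<Omega> D z M' \<longleftrightarrow> integrable_mod \<Omega> D y M"
    using integrable_twisted inv.integrable_twisted by blast
  show "simple_mod \<Omega> D z M' \<longleftrightarrow> simple_mod \<Omega> D y M"
    using simple_twisted inv.simple_twisted U_submodule_twisted inv.U_submodule_twisted by blast
  show "highest_weight_mod \<Omega> D z \<Lambda> M' \<longleftrightarrow> highest_weight_mod \<Omega> D y \<Lambda> M" if "\<Lambda> \<in> L"
    using highest_weight_twisted inv.highest_weight_twisted U_submodule_twisted inv.U_submodule_twisted that
    by blast
qed

end

lemma weight_hom_twisted:
  assumes "twisted_pair \<Omega> L D y z s M M'" and "twisted_pair \<Omega> L D y z s N N'"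
    and h: "h \<in> weight_hom \<Omega> D y L M N"
  shows "h \<in> weight_hom \<Omega> D z L M' N'"
proof -
  interpret M: twisted_pair \<Omega> L D y z s M M' by (rule assms)
  interpret N: twisted_pair \<Omega> L D y z s N N' by (rule assms)
  have h_closed: "h m \<in> carrier N" if "m \<in> carrier M" for m
    using h that by (auto simp: weight_hom_def PiE_iff)
  have h_wt: "h m \<in> wt N \<mu>" if "\<mu> \<in> L" "m \<in> wt M \<mu>" for \<mu> m
    using h that by (simp add: weight_hom_def image_subset_iff)
  have h_add: "h (m \<oplus>\<^bsub>M\<^esub> n) = h m \<oplus>\<^bsub>N\<^esub> h n" if "m \<in> carrier M" "n \<in> carrier M" for m n
    using h that by (simp add: weight_hom_def)
  have h_smult: "h (c \<odot>\<^bsub>M\<^esub> m) = c \<odot>\<^bsub>N\<^esub> h m" if "m \<in> carrier M" for c m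
    using h that by (simp add: weight_hom_def)
  have h_act: "h (act M (U_gen \<Omega> D y g) m) = act N (U_gen \<Omega> D y g) (h m)" if "m \<in> carrier M" for g m
    using h that by (simp add: weight_hom_def U_gen_def)
  have "h (act M' (U_class \<Omega> D z x) m) = act N' (U_class \<Omega> D z x) (h m)" if "m \<in> carrier M'" for x m
  proof (rule intertwines_rep[OF M.M'.cartan_module_axioms N.M'.cartan_module_axioms _ _ _ _ _ _ that])
    fix i \<mu> m assume \<mu>: "\<mu> \<in> L" and "m \<in> wt M' \<mu>"
    then have m: "m \<in> wt M \<mu>" by simp
    note m' = M.M.wt_subset[OF \<mu> m]
    have closed: "act M (U_gen \<Omega> D y g) m \<in> carrier M" for g
      unfolding U_gen_def using m' by (rule M.M.rep_closed)
    show "h (act M' (U_gen \<Omega> D z (GE i)) m) = act N' (U_gen \<Omega> D z (GE i)) (h m)"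
      unfolding M.twisted_E[OF \<mu> m] N.twisted_E[OF \<mu> h_wt[OF \<mu> m]] by (simp add: h_smult closed h_act m')
    show "h (act M' (U_gen \<Omega> D z (GF i)) m) = act N' (U_gen \<Omega> D z (GF i)) (h m)"
      unfolding M.twisted_F[OF \<mu> m] N.twisted_F[OF \<mu> h_wt[OF \<mu> m]] by (simp add: h_smult closed h_act m')
  qed (simp_all add: h_closed h_add h_smult h_wt)
  then show ?thesis
    using h by (auto simp: weight_hom_def elim!: carrier_U_algE)
qed

lemma twisted_pair_unique:
  assumes "twisted_pair \<Omega> L D y z s M M1" and "twisted_pair \<Omega> L D y z s M M2"
  shows "M1 = M2"
proof -
  interpret M1: twisted_pair \<Omega> L D y z s M M1 by (rule assms)
  interpret M2: twisted_pair \<Omega> L D y z s M M2 by (rule assms)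
  have "act M1 (U_class \<Omega> D z x) m = act M2 (U_class \<Omega> D z x) m" if "m \<in> carrier M1" for x m
    by (rule intertwines_rep[OF M1.M'.cartan_module_axioms M2.M'.cartan_module_axioms, of "\<lambda>m. m"])
      (use that in \<open>simp_all add: M1.twisted_E M2.twisted_E M1.twisted_F M2.twisted_F\<close>)
  then have eq: "act M1 u m = act M2 u m" if "u \<in> carrier (U_alg \<Omega> D z)" "m \<in> carrier M" for u m
    using that by (auto elim!: carrier_U_algE)
  have closed: "act M1 u \<in> carrier M \<rightarrow>\<^sub>E carrier M" "act M2 u \<in> carrier M \<rightarrow>\<^sub>E carrier M"
    if "u \<in> carrier (U_alg \<Omega> D z)" for u
    using PiE_mem[OF M1.M'.act_closed that] PiE_mem[OF M2.M'.act_closed that] by simp_all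
  have "act M1 u = act M2 u" if "u \<in> carrier (U_alg \<Omega> D z)" for u
    by (rule PiE_ext[OF closed[OF that] eq[OF that]])
  then have "act M1 = act M2"
    using PiE_ext[OF M1.M'.act_closed[simplified] M2.M'.act_closed[simplified]] by simp
  then show ?thesis
    using M1.same_space M2.same_space by simp
qed


section \<open>The twist equivalence\<close>

lemma (in twist_module) twisted_pair_iff:
  assumes "weight_module \<Omega> D (y * s) (M\<lparr>act := a\<rparr>) L"
  shows "twisted_pair \<Omega> L D y (y * s) s M (M\<lparr>act := a\<rparr>) \<longleftrightarrow> twisted_action a"
proof
  assume "twisted_pair \<Omega> L D y (y * s) s M (M\<lparr>act := a\<rparr>)"
  then interpret pair: twisted_pair \<Omega> L D y "y * s" s M "M\<lparr>act := a\<rparr>" .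
  show "twisted_action a"
    using pair.twisted_E pair.twisted_F by (simp add: twisted_action_def)
next
  assume "twisted_action a"
  then show "twisted_pair \<Omega> L D y (y * s) s M (M\<lparr>act := a\<rparr>)"
    by (intro twisted_pair.intro twisted_pair_axioms.intro cartan_lattice_axioms weight_module_axioms assms)
      (simp_all add: twisted_action_def)
qed

lemma (in twist_module) twisted_action_ex1:
  "\<exists>!a. weight_module \<Omega> D (y * s) (M\<lparr>act := a\<rparr>) L \<and> twisted_action a"
proof -
  obtain a where a: "weight_module \<Omega> D (y * s) (M\<lparr>act := a\<rparr>) L" "twisted_action a"
    by (rule twisted_action_exists)
  show ?thesis
  proof (rule ex1I)
    show "weight_module \<Omega> D (y * s) (M\<lparr>act := a\<rparr>) L \<and> twisted_action a"
      using a by simp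
    fix b assume b: "weight_module \<Omega> D (y * s) (M\<lparr>act := b\<rparr>) L \<and> twisted_action b"
    have "M\<lparr>act := b\<rparr> = M\<lparr>act := a\<rparr>"
      using a b by (intro twisted_pair_unique[of \<Omega> L D y "y * s" s M]) (simp_all add: twisted_pair_iff)
    then show "b = a"
      by (metis wmod.select_convs(1) wmod.surjective wmod.update_convs(1))
  qed
qed

context cartan_lattice
begin

lemma twist_module_at_1:
  fixes M :: "('i, 'm) wmod"
  assumes "weight_module \<Omega> D 1 M L"
  shows "twist_module \<Omega> L D 1 t_root M"
  by (intro twist_module.intro twist.intro twist_axioms.intro cartan_lattice_axioms assms) simp_all

lemma twist_module_at_t:
  fixes N :: "('i, 'm) wmod"
  assumes "weight_module \<Omega> D t_root N L"
  shows "twist_module \<Omega> L D t_root (inverse t_root) N"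
  by (intro twist_module.intro twist.intro twist_axioms.intro cartan_lattice_axioms assms) simp_all

text \<open>The formulas for the Cartan generators hold in any weight module for the target parameter.\<close>

lemma twist_formulas_iff:
  fixes M :: "('i, 'm) wmod"
  assumes "weight_module \<Omega> D 1 M L" and "weight_module \<Omega> D t_root (M\<lparr>act := a\<rparr>) L"
  shows "twist_formulas \<Omega> D L M a \<longleftrightarrow> twist_module.twisted_action \<Omega> L D 1 t_root M a"
proof -
  interpret twist_module \<Omega> L D 1 t_root M by (rule twist_module_at_1[OF assms(1)])
  interpret T: weight_module \<Omega> D t_root "M\<lparr>act := a\<rparr>" L by (rule assms(2))
  show ?thesis
    using T.K_weight T.K'_weight
    by (auto simp: twist_formulas_def twisted_action_def gen_scalar_def)
qed

lemma untwist_formulas_iff: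
  fixes N :: "('i, 'm) wmod"
  assumes "weight_module \<Omega> D t_root N L" and "weight_module \<Omega> D 1 (N\<lparr>act := a\<rparr>) L"
  shows "untwist_formulas \<Omega> D L N a \<longleftrightarrow> twist_module.twisted_action \<Omega> L D t_root (inverse t_root) N a"
proof -
  interpret twist_module \<Omega> L D t_root "inverse t_root" N by (rule twist_module_at_t[OF assms(1)])
  interpret T: weight_module \<Omega> D 1 "N\<lparr>act := a\<rparr>" L by (rule assms(2))
  have gs: "gs \<mu> g = fpow D t_root (- gen_exponent \<Omega> \<mu> g)" if "\<mu> \<in> L" for \<mu> g
    using that by (simp add: gen_scalar_def fpow_base_inverse)
  have K: "a (U_gen \<Omega> D 1 (GK i)) m = fpow D t_root (- eform \<Omega> \<mu> (simple_root i) + eform \<Omega> (simple_root i) \<mu>)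
         \<odot>\<^bsub>N\<^esub> act N (U_gen \<Omega> D t_root (GK i)) m"
    "a (U_gen \<Omega> D 1 (GK' i)) m = fpow D t_root (- eform \<Omega> \<mu> (simple_root i) + eform \<Omega> (simple_root i) \<mu>)
         \<odot>\<^bsub>N\<^esub> act N (U_gen \<Omega> D t_root (GK' i)) m"
    if "\<mu> \<in> L" "m \<in> wt N \<mu>" for \<mu> m i
  proof -
    \<comment> \<open>The power of \<open>t\<close> in the formula cancels the one by which the Cartan generators act on \<open>N\<close>.\<close>
    define q where "q = eform \<Omega> \<mu> (simple_root i) - eform \<Omega> (simple_root i) \<mu>"
    have "q \<in> exponents D" using that by (simp add: q_def exponents_diff)
    then have "fpow D t_root (- q) * fpow D t_root q = 1"
      by (simp add: fpow_uminus)
    then have cancel: "c = fpow D t_root (- q) * (c * fpow D t_root q)" for c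
      by (simp add: mult.left_commute)
    have q: "- eform \<Omega> \<mu> (simple_root i) + eform \<Omega> (simple_root i) \<mu> = - q"
      by (simp add: q_def)
    have assoc: "c \<odot>\<^bsub>N\<^esub> (d \<odot>\<^bsub>N\<^esub> m) = (c * d) \<odot>\<^bsub>N\<^esub> m" for c d
      using smult_assoc1[of c d m] wt_subset[OF that] by simp
    show "a (U_gen \<Omega> D 1 (GK i)) m = fpow D t_root (- eform \<Omega> \<mu> (simple_root i) + eform \<Omega> (simple_root i) \<mu>)
         \<odot>\<^bsub>N\<^esub> act N (U_gen \<Omega> D t_root (GK i)) m"
      "a (U_gen \<Omega> D 1 (GK' i)) m = fpow D t_root (- eform \<Omega> \<mu> (simple_root i) + eform \<Omega> (simple_root i) \<mu>)
         \<odot>\<^bsub>N\<^esub> act N (U_gen \<Omega> D t_root (GK' i)) m"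
      unfolding q K_weight[OF that] K'_weight[OF that] q_def[symmetric] assoc cancel[symmetric]
      using T.K_weight[of \<mu> m i] T.K'_weight[of \<mu> m i] that by simp_all
  qed
  show ?thesis
    using K by (auto simp: untwist_formulas_def twisted_action_def gs)
qed

lemma twist_ex1:
  fixes M :: "('i, 'm) wmod"
  assumes "weight_module \<Omega> D 1 M L"
  shows "\<exists>!a. weight_module \<Omega> D t_root (M\<lparr>act := a\<rparr>) L \<and> twist_formulas \<Omega> D L M a"
  using twist_module.twisted_action_ex1[OF twist_module_at_1[OF assms]] twist_formulas_iff[OF assms]
  by (simp cong: conj_cong)

lemma untwist_ex1:
  fixes N :: "('i, 'm) wmod"
  assumes "weight_module \<Omega> D t_root N L"
  shows "\<exists>!a. weight_module \<Omega> D 1 (N\<lparr>act := a\<rparr>) L \<and> untwist_formulas \<Omega> D L N a"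
  using twist_module.twisted_action_ex1[OF twist_module_at_t[OF assms]] untwist_formulas_iff[OF assms]
  by (simp cong: conj_cong)

lemma twisted_pair_Phi:
  fixes M :: "('i, 'm) wmod"
  assumes "weight_module \<Omega> D 1 M L"
  shows "twisted_pair \<Omega> L D 1 t_root t_root M (Phi \<Omega> D L M)"
proof -
  obtain a where a: "weight_module \<Omega> D t_root (M\<lparr>act := a\<rparr>) L" "twist_formulas \<Omega> D L M a"
    and Phi: "Phi \<Omega> D L M = M\<lparr>act := a\<rparr>"
    using theI'[OF twist_ex1[OF assms]] by (auto simp: Phi_def)
  show ?thesis
    unfolding Phi
    using twist_module.twisted_pair_iff[OF twist_module_at_1[OF assms], of a] a
      twist_formulas_iff[OF assms a(1)] by simp
qed

lemma twisted_pair_Psi: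
  fixes N :: "('i, 'm) wmod"
  assumes "weight_module \<Omega> D t_root N L"
  shows "twisted_pair \<Omega> L D t_root 1 (inverse t_root) N (Psi \<Omega> D L N)"
proof -
  obtain a where a: "weight_module \<Omega> D 1 (N\<lparr>act := a\<rparr>) L" "untwist_formulas \<Omega> D L N a"
    and Psi: "Psi \<Omega> D L N = N\<lparr>act := a\<rparr>"
    using theI'[OF untwist_ex1[OF assms]] by (auto simp: Psi_def)
  show ?thesis
    unfolding Psi
    using twist_module.twisted_pair_iff[OF twist_module_at_t[OF assms], of a] a
      untwist_formulas_iff[OF assms a(1)] by simp
qed

lemma weight_module_Phi:
  fixes M :: "('i, 'm) wmod"
  assumes "weight_module \<Omega> D 1 M L" shows "weight_module \<Omega> D t_root (Phi \<Omega> D L M) L"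
  using twisted_pair.axioms(3)[OF twisted_pair_Phi[OF assms]] .

lemma weight_module_Psi:
  fixes N :: "('i, 'm) wmod"
  assumes "weight_module \<Omega> D t_root N L" shows "weight_module \<Omega> D 1 (Psi \<Omega> D L N) L"
  using twisted_pair.axioms(3)[OF twisted_pair_Psi[OF assms]] .

lemma Psi_Phi:
  fixes M :: "('i, 'm) wmod"
  assumes "weight_module \<Omega> D 1 M L" shows "Psi \<Omega> D L (Phi \<Omega> D L M) = M"
  by (rule twisted_pair_unique[OF twisted_pair_Psi[OF weight_module_Phi[OF assms]]
        twisted_pair.symmetric[OF twisted_pair_Phi[OF assms]]])

lemma Phi_Psi:
  fixes N :: "('i, 'm) wmod"
  assumes "weight_module \<Omega> D t_root N L" shows "Phi \<Omega> D L (Psi \<Omega> D L N) = N"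
  using twisted_pair_unique[OF twisted_pair_Phi[OF weight_module_Psi[OF assms]]]
    twisted_pair.symmetric[OF twisted_pair_Psi[OF assms]] by simp

end

lemma is_category_weight_cat:
  "is_category (weight_cat \<Omega> D y L :: (('i::finite, 'm) wmod, 'm \<Rightarrow> 'm) cat)"
proof
  fix X :: "('i, 'm) wmod"
  assume "X \<in> Ob (weight_cat \<Omega> D y L)"
  then interpret X: weight_module \<Omega> D y X L by (simp add: weight_cat_def)
  have wt: "m \<in> carrier X" if "\<mu> \<in> L" "m \<in> wt X \<mu>" for \<mu> m
    by (rule X.wt_subset[OF that])
  show "Ident (weight_cat \<Omega> D y L) X \<in> Hom (weight_cat \<Omega> D y L) X X"
    using X.rep_closed wt by (auto simp: weight_cat_def weight_hom_def elim!: carrier_U_algE)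
next
  fix X Y Z :: "('i, 'm) wmod" and f g
  assume "X \<in> Ob (weight_cat \<Omega> D y L)" "Y \<in> Ob (weight_cat \<Omega> D y L)"
    and fg: "f \<in> Hom (weight_cat \<Omega> D y L) X Y" "g \<in> Hom (weight_cat \<Omega> D y L) Y Z"
  then interpret X: weight_module \<Omega> D y X L by (simp add: weight_cat_def)
  have wt: "m \<in> carrier X" if "\<mu> \<in> L" "m \<in> wt X \<mu>" for \<mu> m
    by (rule X.wt_subset[OF that])
  have closed: "f m \<in> carrier Y" if "m \<in> carrier X" for m
    using fg that by (auto simp: weight_cat_def weight_hom_def PiE_iff)
  show "Comp (weight_cat \<Omega> D y L) X Y Z g f \<in> Hom (weight_cat \<Omega> D y L) X Z"
    using fg closed X.rep_closed wt
    by (auto simp: weight_cat_def weight_hom_def compose_def PiE_iff image_subset_iff elim!: carrier_U_algE)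
next
  fix X Y :: "('i, 'm) wmod" and f
  assume "f \<in> Hom (weight_cat \<Omega> D y L) X Y"
  then have "f \<in> carrier X \<rightarrow>\<^sub>E carrier Y" by (simp add: weight_cat_def weight_hom_def)
  then show "Comp (weight_cat \<Omega> D y L) X X Y f (Ident (weight_cat \<Omega> D y L) X) = f"
    "Comp (weight_cat \<Omega> D y L) X Y Y (Ident (weight_cat \<Omega> D y L) Y) f = f"
    by (auto simp: weight_cat_def compose_def fun_eq_iff PiE_iff extensional_def restrict_def)
next
  fix W X Y Z :: "('i, 'm) wmod" and f g h
  assume "f \<in> Hom (weight_cat \<Omega> D y L) W X"
  then have "f \<in> carrier W \<rightarrow>\<^sub>E carrier X" by (simp add: weight_cat_def weight_hom_def)
  then show "Comp (weight_cat \<Omega> D y L) W X Z (Comp (weight_cat \<Omega> D y L) X Y Z h g) f =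
      Comp (weight_cat \<Omega> D y L) W Y Z h (Comp (weight_cat \<Omega> D y L) W X Y g f)"
    by (auto simp: weight_cat_def compose_def fun_eq_iff PiE_iff restrict_def)
qed

text \<open>Functors that are the identity on arrows and inverse to each other on objects: the identities serve as
  unit and counit.\<close>

lemma inverse_functors_equivalence:
  assumes F: "is_functor C D Fo (\<lambda>X Y f. f)" and G: "is_functor D C Go (\<lambda>X Y f. f)"
    and GF: "\<And>X. X \<in> Ob C \<Longrightarrow> Go (Fo X) = X" and FG: "\<And>Y. Y \<in> Ob D \<Longrightarrow> Fo (Go Y) = Y"
  shows "equivalence_of_categories C D Fo (\<lambda>X Y f. f) Go (\<lambda>X Y f. f)"
proof -
  interpret F: is_functor C D Fo "\<lambda>X Y f. f" by (rule F)
  have "natural_isomorphism C C (\<lambda>X. X) (\<lambda>X Y f. f) (\<lambda>X. Go (Fo X)) (\<lambda>X Y f. f) (Ident C)"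
    using F.C.Ident_Hom F.C.Ident_right F.C.Ident_left
    by (auto simp: natural_isomorphism_def isomorphism_def GF)
  moreover have "natural_isomorphism D D (\<lambda>X. Fo (Go X)) (\<lambda>X Y f. f) (\<lambda>X. X) (\<lambda>X Y f. f) (Ident D)"
    using F.D.Ident_Hom F.D.Ident_right F.D.Ident_left
    by (auto simp: natural_isomorphism_def isomorphism_def FG)
  ultimately show ?thesis
    using F G by (auto simp: equivalence_of_categories_def)
qed

lemma is_functor_twist:
  fixes \<Phi> :: "('i::finite, 'm) wmod \<Rightarrow> ('i, 'm) wmod"
  assumes pair: "\<And>M. weight_module \<Omega> D y M L \<Longrightarrow> twisted_pair \<Omega> L D y z s M (\<Phi> M)"
  shows "is_functor (weight_cat \<Omega> D y L) (weight_cat \<Omega> D z L) \<Phi> (\<lambda>X Y f. f)"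
proof (intro is_functor.intro is_category_weight_cat is_functor_axioms.intro)
  have carrier: "carrier (\<Phi> X) = carrier X" if "weight_module \<Omega> D y X L" for X
    using twisted_pair.same_space_simps(1)[OF pair[OF that]] .
  show "\<Phi> X \<in> Ob (weight_cat \<Omega> D z L)" if "X \<in> Ob (weight_cat \<Omega> D y L)" for X
    using twisted_pair.axioms(3)[OF pair, of X] that by (simp add: weight_cat_def)
  show "f \<in> Hom (weight_cat \<Omega> D z L) (\<Phi> X) (\<Phi> Y)"
    if "X \<in> Ob (weight_cat \<Omega> D y L)" "Y \<in> Ob (weight_cat \<Omega> D y L)"
      "f \<in> Hom (weight_cat \<Omega> D y L) X Y" for X Y f
    using weight_hom_twisted[OF pair[of X] pair[of Y], of f] that by (simp add: weight_cat_def)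
  show "Ident (weight_cat \<Omega> D y L) X = Ident (weight_cat \<Omega> D z L) (\<Phi> X)"
    if "X \<in> Ob (weight_cat \<Omega> D y L)" for X
    using that by (simp add: weight_cat_def carrier)
  show "Comp (weight_cat \<Omega> D y L) X Y Z g f = Comp (weight_cat \<Omega> D z L) (\<Phi> X) (\<Phi> Y) (\<Phi> Z) g f"
    if "X \<in> Ob (weight_cat \<Omega> D y L)" for X Y Z f g
    using that by (simp add: weight_cat_def carrier)
qed

theorem theorem3p1:
  fixes \<Omega> :: "'i::finite \<Rightarrow> 'i \<Rightarrow> int" and L :: "(rat ^ 'i) set" and D :: nat
  assumes "finite_cartan_datum \<Omega>"
    and "admissible_lattice L"
    and "common_denominator \<Omega> L D"
  shows "(\<forall>M :: ('i, 'm) wmod. weight_module \<Omega> D 1 M L \<longrightarrow>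
       (\<exists>!a. weight_module \<Omega> D t_root (M\<lparr>act := a\<rparr>) L \<and> twist_formulas \<Omega> D L M a))
    \<and> (\<forall>N :: ('i, 'm) wmod. weight_module \<Omega> D t_root N L \<longrightarrow>
       (\<exists>!a. weight_module \<Omega> D 1 (N\<lparr>act := a\<rparr>) L \<and> untwist_formulas \<Omega> D L N a))
    \<and> equivalence_of_categories
       (weight_cat \<Omega> D 1 L :: (('i, 'm) wmod, 'm \<Rightarrow> 'm) cat) (weight_cat \<Omega> D t_root L)
       (Phi \<Omega> D L) (\<lambda>M N h. h) (Psi \<Omega> D L) (\<lambda>M N h. h)
    \<and> (\<forall>M :: ('i, 'm) wmod. weight_module \<Omega> D 1 M L \<longrightarrow> Psi \<Omega> D L (Phi \<Omega> D L M) = M)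
    \<and> (\<forall>N :: ('i, 'm) wmod. weight_module \<Omega> D t_root N L \<longrightarrow> Phi \<Omega> D L (Psi \<Omega> D L N) = N)
    \<and> (\<forall>M :: ('i, 'm) wmod. weight_module \<Omega> D 1 M L \<longrightarrow>
       (fin_dim (Phi \<Omega> D L M) \<longleftrightarrow> fin_dim M) \<and>
       (integrable_mod \<Omega> D t_root (Phi \<Omega> D L M) \<longleftrightarrow> integrable_mod \<Omega> D 1 M) \<and>
       (simple_mod \<Omega> D t_root (Phi \<Omega> D L M) \<longleftrightarrow> simple_mod \<Omega> D 1 M) \<and>
       (\<forall>\<Lambda>\<in>L. highest_weight_mod \<Omega> D t_root \<Lambda> (Phi \<Omega> D L M) \<longleftrightarrow>
          highest_weight_mod \<Omega> D 1 \<Lambda> M))"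
proof -
  interpret cartan_lattice \<Omega> L D
    using assms by (rule cartan_lattice.intro)
  have "equivalence_of_categories
       (weight_cat \<Omega> D 1 L :: (('i, 'm) wmod, 'm \<Rightarrow> 'm) cat) (weight_cat \<Omega> D t_root L)
       (Phi \<Omega> D L) (\<lambda>M N h. h) (Psi \<Omega> D L) (\<lambda>M N h. h)"
    by (rule inverse_functors_equivalence[OF is_functor_twist[OF twisted_pair_Phi]
          is_functor_twist[OF twisted_pair_Psi]])
      (simp_all add: weight_cat_def Psi_Phi Phi_Psi)
  then show ?thesis
    by (intro conjI allI impI ballI twist_ex1 untwist_ex1 Psi_Phi Phi_Psi
        twisted_pair.twist_invariants[OF twisted_pair_Phi])
qed

end
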